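(* Let $Y=X\beta+\epsilon$ with $\beta\in\mathbb{R}^p$ $s$-sparse and $\epsilon=(\epsilon_1,\dots,\epsilon_n)^T$ having i.i.d. $N(0,\sigma^2)$ entries, and suppose the columns of $X$ have $\ell_2$ norm $\sqrt n$. Let $s_0$ be the essential sparsity of $\beta$. Suppose that $\mathrm{RE}(s_0,4,X)$ holds with $K(s_0,4)$, and that $\Lambda_{\max}(2s)<\infty$ and $\Lambda_{\min}(2s)>0$. Let $a\ge 0$, $d_0\ge 2\sqrt{1+a}$, and let $\beta_{\mathrm{init}}$ be an optimal solution of the Lasso $$\min_{b\in\mathbb{R}^p}\ \frac1{2n}\|Y-Xb\|_2^2+\lambda_n\|b\|_1,\qquad \lambda_n=d_0\lambda\sigma\ \ (\ge 2\lambda_{\sigma,a,p}).$$ Set $t_0=C_4\lambda\sigma\ge 2\sqrt{1+a}\,\lambda\sigma$ for some constant $C_4\ge D_1$. Set $I=\{j\in[p]:|\beta_{j,\mathrm{init}}|\ge t_0\}$, $\hat\beta_I=(X_I^TX_I)^{-1}X_I^TY$ and $\hat\beta_{I^c}=0$. Then with probability at least $1-\mathbb{P}(\mathcal{T}_a^c)$, $$|I|\le s_0(1+D_1/C_4)\le 2s_0,\qquad |I\cup S|\le s+s_0,\qquad \|\hat\beta-\beta\|_2^2\le D_4^2\,s_0\lambda^2\sigma^2,$$ where $$D_4^2\le\big((D_0'+C_4)^2+1\big)\left(\frac32+\frac{(\Lambda_{\max}(2s)-\Lambda_{\min}(2s))^2}{2\Lambda_{\min}^2(2s_0)}\right).$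$
   Context: Setting: $n,p$ are positive integers with $p\ge n$, $p\ge2$; $[p]=\{1,\dots,p\}$; $X\in\mathbb{R}^{n\times p}$ is a fixed design matrix with columns $X_j$; $\sigma>0$; $S=\mathrm{supp}(\beta)$ and $s=|S|$; $\lambda=\sqrt{2\log p/n}$. For $T\subseteq[p]$, $X_T$ is the submatrix of columns indexed by $T$, and $v_T$ is the restriction of a vector $v$ to $T$. A vector is $m$-sparse if it has at most $m$ nonzero entries. $x\vee y=\max(x,y)$, $x\wedge y=\min(x,y)$. Essential sparsity: $s_0$ is the smallest integer such that $\sum_{i=1}^p\min(\beta_i^2,\lambda^2\sigma^2)\le s_0\lambda^2\sigma^2$. Sparse eigenvalues: $\Lambda_{\max}(m)=\max\|Xv\|_2^2/(n\|v\|_2^2)$ and $\Lambda_{\min}(m)=\min\|Xv\|_2^2/(n\|v\|_2^2)$, both over nonzero $m$-sparse $v\in\mathbb{R}^p$; $\Lambda_{\max}(0)=0$. Restricted orthogonality: $\theta_{m,m'}$ is the smallest number such that $|\langle X_Tv,X_{T'}v'\rangle|/n\le\theta_{m,m'}\|v\|_2\|v'\|_2$ for all disjoint $T,T'\subseteq[p]$ with $|T|\le m$, $|T'|\le m'$ and all $v\in\mathbb{R}^{|T|},v'\in\mathbb{R}^{|T'|}$. Restricted eigenvalue: for $m\in[p]$, $k_0>0$, $\mathrm{RE}(m,k_0,X)$ holds with $K(m,k_0)$ if $$\frac1{K(m,k_0)}:=\min_{J\subseteq[p],|J|\le m}\ \min_{v\ne0,\ \|v_{J^c}\|_1\le k_0\|v_J\|_1}\frac{\|Xv\|_2}{\sqrt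 n\,\|v_J\|_2}>0.$$ Noise event: for $a\ge0$, $\lambda_{\sigma,a,p}=\sigma\sqrt{1+a}\sqrt{2\log p/n}$ and $\mathcal{T}_a=\{\epsilon:\|X^T\epsilon/n\|_\infty\le\lambda_{\sigma,a,p}\}$. Constants: $$\ell(s_0)=\frac{\theta_{s_0,2s_0}}{\sqrt{\Lambda_{\min}(2s_0)}}\wedge\sqrt{\Lambda_{\max}(s_0)},\qquad D=\sqrt{\frac{\Lambda_{\max}(s-s_0)}{\Lambda_{\min}(2s_0)}}\Big(1+\frac{3\ell(s_0)\sqrt{\Lambda_{\max}(s-s_0)}}{d_0}\Big),$$ $$D_0'=D\vee\big(d_0K^2(s_0,4)\big)\vee\big(K(s_0,3)\sqrt{\Lambda_{\max}(s-s_0)}+3d_0K^2(s_0,3)\big),$$ $$D_1=d_0\Big[\Big(\frac{\Lambda_{\max}(s-s_0)}{d_0^2}+\frac94K^2(s_0,3)\Big)\vee4K^2(s_0,4)\vee\frac{3\Lambda_{\max}(s-s_0)}{d_0^2}\Big].$$ *)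

theory Defs
  imports "HOL-Probability.Probability"
begin

text \<open>
  The index sets of rows and columns are the finite types \<open>'n\<close> and \<open>'p\<close>; a vector indexed by
  a subset \<open>T\<close> of the columns is represented by its zero extension to \<open>'p\<close>, so that
  \<open>X_T v_T\<close> is \<open>X *v restr T v\<close>.
\<close>

definition supp :: "real^'p \<Rightarrow> 'p set" where
  "supp v = {j. v $ j \<noteq> 0}"

definition restr :: "'p set \<Rightarrow> real^'p \<Rightarrow> real^'p" where
  "restr T v = (\<chi> j. if j \<in> T then v $ j else 0)"

definition l1norm :: "real^'p \<Rightarrow> real" where
  "l1norm v = (\<Sum>j\<in>UNIV. \<bar>v $ j\<bar>)"

text \<open>Essential sparsity of \<open>\<beta>\<close> at noise level \<open>\<tau> = \<lambda>\<sigma>\<close>. The sum is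
  nonnegative, so for \<open>\<tau> > 0\<close> the smallest integer is a natural number.\<close>

definition ess_sparsity :: "real^'p \<Rightarrow> real \<Rightarrow> nat" where
  "ess_sparsity \<beta> \<tau> =
     (LEAST m::nat. (\<Sum>i\<in>UNIV. min ((\<beta> $ i)\<^sup>2) (\<tau>\<^sup>2)) \<le> real m * \<tau>\<^sup>2)"

definition sparse_quotients :: "real^'p^'n \<Rightarrow> nat \<Rightarrow> real set" where
  "sparse_quotients X m =
     {(norm (X *v v))\<^sup>2 / (real CARD('n) * (norm v)\<^sup>2) | v. v \<noteq> 0 \<and> card (supp v) \<le> m}"

text \<open>The maxima and minima below are attained whenever the set is nonempty (compactness of
  the unit sphere), so they coincide with \<open>Sup\<close> and \<open>Inf\<close>.\<close>

definition Lmax :: "real^'p^'n \<Rightarrow> nat \<Rightarrow> real" where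
  "Lmax X m = (if m = 0 then 0 else Sup (sparse_quotients X m))"

definition Lmin :: "real^'p^'n \<Rightarrow> nat \<Rightarrow> real" where
  "Lmin X m = Inf (sparse_quotients X m)"

definition restr_orth :: "real^'p^'n \<Rightarrow> nat \<Rightarrow> nat \<Rightarrow> real" where
  "restr_orth X m m' =
     (LEAST c::real. \<forall>T T' v v'. T \<inter> T' = {} \<and> card T \<le> m \<and> card T' \<le> m' \<longrightarrow>
        \<bar>(X *v restr T v) \<bullet> (X *v restr T' v')\<bar> / real CARD('n)
          \<le> c * norm (restr T v) * norm (restr T' v'))"

definition RE_quotients :: "real^'p^'n \<Rightarrow> nat \<Rightarrow> real \<Rightarrow> real set" where
  "RE_quotients X m k =
     {norm (X *v v) / (sqrt (real CARD('n)) * norm (restr J v)) | J v.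
        card J \<le> m \<and> v \<noteq> 0 \<and> l1norm (restr (- J) v) \<le> k * l1norm (restr J v)}"

definition RE :: "real^'p^'n \<Rightarrow> nat \<Rightarrow> real \<Rightarrow> bool" where
  "RE X m k \<longleftrightarrow> m \<in> {1..CARD('p)} \<and> k > 0 \<and> Inf (RE_quotients X m k) > 0"

definition REK :: "real^'p^'n \<Rightarrow> nat \<Rightarrow> real \<Rightarrow> real" where
  "REK X m k = 1 / Inf (RE_quotients X m k)"

definition noise_level :: "real^'p^'n \<Rightarrow> real \<Rightarrow> real \<Rightarrow> real" where
  "noise_level X \<sigma> a = \<sigma> * sqrt (1 + a) * sqrt (2 * ln (real CARD('p)) / real CARD('n))"

definition noise_event :: "real^'p^'n \<Rightarrow> real \<Rightarrow> real \<Rightarrow> (real^'n) set" where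
  "noise_event X \<sigma> a =
     {e. infnorm ((1 / real CARD('n)) *\<^sub>R (transpose X *v e)) \<le> noise_level X \<sigma> a}"

definition ell :: "real^'p^'n \<Rightarrow> nat \<Rightarrow> real" where
  "ell X s0 = min (restr_orth X s0 (2 * s0) / sqrt (Lmin X (2 * s0))) (sqrt (Lmax X s0))"

text \<open>In the constants below, \<open>s - s0\<close> is subtraction of naturals; the essential sparsity
  never exceeds the sparsity.\<close>

definition D_const :: "real^'p^'n \<Rightarrow> nat \<Rightarrow> nat \<Rightarrow> real \<Rightarrow> real" where
  "D_const X s s0 d0 =
     sqrt (Lmax X (s - s0) / Lmin X (2 * s0)) * (1 + 3 * ell X s0 * sqrt (Lmax X (s - s0)) / d0)"

definition D0'_const :: "real^'p^'n \<Rightarrow> nat \<Rightarrow> nat \<Rightarrow> real \<Rightarrow> real" where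
  "D0'_const X s s0 d0 =
     max (D_const X s s0 d0)
       (max (d0 * (REK X s0 4)\<^sup>2)
            (REK X s0 3 * sqrt (Lmax X (s - s0)) + 3 * d0 * (REK X s0 3)\<^sup>2))"

definition D1_const :: "real^'p^'n \<Rightarrow> nat \<Rightarrow> nat \<Rightarrow> real \<Rightarrow> real" where
  "D1_const X s s0 d0 =
     d0 * max (Lmax X (s - s0) / d0\<^sup>2 + 9 / 4 * (REK X s0 3)\<^sup>2)
            (max (4 * (REK X s0 4)\<^sup>2) (3 * Lmax X (s - s0) / d0\<^sup>2))"

definition lasso_objective :: "real^'p^'n \<Rightarrow> real^'n \<Rightarrow> real \<Rightarrow> real^'p \<Rightarrow> real" where
  "lasso_objective X y l b = 1 / (2 * real CARD('n)) * (norm (y - X *v b))\<^sup>2 + l * l1norm b"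

text \<open>Inverse of the \<open>I \<times> I\<close> block of a square matrix; as for \<^const>\<open>matrix_inv\<close>, the value
  is unspecified if the block is singular. Only the entries in \<open>I \<times> I\<close> are meaningful.\<close>

definition block_inv :: "'p set \<Rightarrow> real^'p^'p \<Rightarrow> real^'p^'p" where
  "block_inv I A = (SOME B. \<forall>i\<in>I. \<forall>j\<in>I.
      (\<Sum>k\<in>I. A $ i $ k * B $ k $ j) = (if i = j then 1 else 0) \<and>
      (\<Sum>k\<in>I. B $ i $ k * A $ k $ j) = (if i = j then 1 else 0))"

text \<open>\<open>(X_I^T X_I)^{-1} X_I^T y\<close> on \<open>I\<close> and \<open>0\<close> off \<open>I\<close>: \<open>X_I^T X_I\<close> is the \<open>I \<times> I\<close> block of
  \<open>X^T X\<close>, and \<open>X_I^T y\<close> consists of the \<open>I\<close>-entries of \<open>X^T y\<close>.\<close>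

definition ols :: "real^'p^'n \<Rightarrow> real^'n \<Rightarrow> 'p set \<Rightarrow> real^'p" where
  "ols X y I = (\<chi> j. if j \<in> I
      then (\<Sum>k\<in>I. block_inv I (transpose X ** X) $ j $ k * (transpose X *v y) $ k)
      else 0)"

end

theory Submission imports Defs begin

text \<open>
  Write \<open>\<tau>\<close> for \<open>lam * \<sigma>\<close>. At most \<open>s0\<close> coefficients reach the level \<open>\<tau>\<close>; let \<open>T\<close> contain them and
  have \<open>s0\<close> elements, so that the part of \<open>\<beta>\<close> off \<open>T\<close> has squared length at most \<open>s0 * \<tau>\<^sup>2\<close>
  (\<open>essential_support\<close>). The Lasso is compared not with \<open>\<beta>\<close> but with its restriction to \<open>T\<close>: the
  tail is treated as an unexplained signal, of prediction norm \<open>B\<close>. Let \<open>h\<close> be the resulting error,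
  \<open>A\<close> its prediction norm, and \<open>w\<close> and \<open>u\<close> the \<open>l1\<close> norms of \<open>h\<close> on and off \<open>T\<close>, times the penalty
  level.

  On the noise event the first-order optimality condition gives
  \<open>2 * A\<^sup>2 + u \<le> 2 * A * B + 3 * w\<close> (\<open>lasso_basic_inequality\<close>). The factor \<open>2\<close> in front of \<open>A\<^sup>2\<close>
  is essential. Comparing only the values of the objective yields the inequality with \<open>A\<^sup>2\<close>, which
  allows \<open>u\<close> up to \<open>4 * B\<^sup>2\<close> outside the cones, whereas the constant \<open>D1\<close> provides for
  \<open>3 * B\<^sup>2\<close> only. With the sharper form, a distinction of whether \<open>h\<close> lies in the cone
  with factor \<open>3\<close>, with factor \<open>4\<close>, or in neither, leads to the three terms of \<open>D1\<close>
  (\<open>cone_case_analysis\<close>) and also bounds \<open>A\<close>. In the cones \<open>A\<close> controls \<open>h\<close> on \<open>T\<close> by the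
  restricted eigenvalue condition. Outside both, and also in the larger cone if \<open>A\<close> is large,
  \<open>A\<close> is at most \<open>B\<close> and \<open>u\<close> at most \<open>3 * B\<^sup>2\<close>. Then \<open>h\<close> is cut into blocks of decreasing size
  (\<open>shelling\<close>), and the sparse eigenvalues with restricted orthogonality bound it on \<open>T\<close>, which is
  the origin of the constant \<open>D\<close>. Together these are \<open>lasso_error_bounds\<close>.

  Thresholding then is counting. False selections off \<open>T\<close> each cost \<open>C4 * \<tau>\<close> of an \<open>l1\<close> error
  at most \<open>D1 * s0 * \<tau>\<close>, and a coefficient in \<open>T\<close> is lost only if it is at most the threshold
  plus its Lasso error. Least squares on the selected set adds an error controlled by the normal
  equations (\<open>ols_error_bound\<close>): the lost coefficients leak in through the correlation
  of disjoint sparse vectors, at most half the spread of the sparse eigenvalues, and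
  the noise contributes \<open>4 * (1 + a) * s0 * \<tau>\<^sup>2 / (Lmin X (2 * s0))\<^sup>2\<close>. The restricted eigenvalue
  condition bounds \<open>Lmin X (2 * s0)\<close> from below (\<open>Lmin_ge_RE\<close>), and so the latter is at most half of
  \<open>((D0' + C4)\<^sup>2 + 1) * s0 * \<tau>\<^sup>2\<close>; this is the step from \<open>1\<close> to \<open>3 / 2\<close> in the final constant.

  All of this is deterministic on the noise event (\<open>thresholded_lasso_bounds\<close>).
\<close>


section \<open>Restricting vectors to coordinate sets\<close>

lemma norm_sq_sum: "(norm v)\<^sup>2 = (\<Sum>j\<in>UNIV. (v $ j)\<^sup>2)" for v :: "real^'p"
  by (simp add: norm_vec_def L2_set_def sum_nonneg)

lemma restr_nth [simp]: "restr T v $ j = (if j \<in> T then v $ j else 0)"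
  by (simp add: restr_def)

lemma restr_compl_add: "restr T v + restr (- T) v = v"
  by (simp add: vec_eq_iff)

lemma restr_inter: "restr T (restr U v) = restr (T \<inter> U) v"
  by (simp add: vec_eq_iff)

lemma restr_eq_self: "supp v \<subseteq> T \<Longrightarrow> restr T v = v"
  by (auto simp: vec_eq_iff supp_def)

lemma supp_restr: "supp (restr T v) = T \<inter> supp v"
  by (auto simp: supp_def)

lemma supp_nonempty_iff: "supp v = {} \<longleftrightarrow> v = 0"
  by (auto simp: supp_def vec_eq_iff)

lemma norm_restr_sq: "(norm (restr T v))\<^sup>2 = (\<Sum>j\<in>T. (v $ j)\<^sup>2)" for v :: "real^'p"
proof -
  have "(norm (restr T v))\<^sup>2 = (\<Sum>j\<in>UNIV. if j \<in> T then (v $ j)\<^sup>2 else 0)"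
    unfolding norm_sq_sum by (intro sum.cong) auto
  also have "\<dots> = (\<Sum>j\<in>T. (v $ j)\<^sup>2)"
    by (simp add: sum.inter_restrict[symmetric])
  finally show ?thesis .
qed

lemma l1norm_restr: "l1norm (restr T v) = (\<Sum>j\<in>T. \<bar>v $ j\<bar>)" for v :: "real^'p"
proof -
  have "l1norm (restr T v) = (\<Sum>j\<in>UNIV. if j \<in> T then \<bar>v $ j\<bar> else 0)"
    unfolding l1norm_def by (intro sum.cong) auto
  also have "\<dots> = (\<Sum>j\<in>T. \<bar>v $ j\<bar>)"
    by (simp add: sum.inter_restrict[symmetric])
  finally show ?thesis .
qed

lemma norm_sq_split: "(norm v)\<^sup>2 = (norm (restr T v))\<^sup>2 + (norm (restr (- T) v))\<^sup>2"
  for v :: "real^'p"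
  unfolding norm_restr_sq norm_sq_sum[of v]
  using sum.subset_diff[of T UNIV "\<lambda>j. (v $ j)\<^sup>2"] by (simp add: Compl_eq_Diff_UNIV)

lemma l1norm_split: "l1norm v = l1norm (restr T v) + l1norm (restr (- T) v)"
  for v :: "real^'p"
  unfolding l1norm_restr
  using sum.subset_diff[of T UNIV "\<lambda>j. \<bar>v $ j\<bar>"] by (simp add: l1norm_def Compl_eq_Diff_UNIV)

lemma norm_restr_mono: "T \<subseteq> U \<Longrightarrow> norm (restr T v) \<le> norm (restr U v)" for v :: "real^'p"
  by (rule power2_le_imp_le) (auto simp: norm_restr_sq intro: sum_mono2)

lemma l1norm_nonneg: "0 \<le> l1norm v"
  by (simp add: l1norm_def sum_nonneg)

lemma l1norm_add_le: "l1norm (v + w) \<le> l1norm v + l1norm w"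
  unfolding l1norm_def sum.distrib[symmetric] by (intro sum_mono) auto

lemma l1norm_diff_le: "l1norm v - l1norm w \<le> l1norm (v - w)"
  using l1norm_add_le[of "v - w" w] by simp

lemma l1norm_scaleR: "l1norm (c *\<^sub>R v) = \<bar>c\<bar> * l1norm v"
  by (simp add: l1norm_def abs_mult sum_distrib_left)

lemma l1norm_restr_le: "l1norm (restr T v) \<le> sqrt (real (card T)) * norm (restr T v)"
  for v :: "real^'p"
proof (rule power2_le_imp_le)
  have "(\<Sum>j\<in>T. \<bar>v $ j\<bar> * 1)\<^sup>2 \<le> (\<Sum>j\<in>T. \<bar>v $ j\<bar>\<^sup>2) * (\<Sum>j\<in>T. 1\<^sup>2)"
    by (rule Cauchy_Schwarz_ineq_sum)
  then show "(l1norm (restr T v))\<^sup>2 \<le> (sqrt (real (card T)) * norm (restr T v))\<^sup>2"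
    by (simp add: l1norm_restr power_mult_distrib norm_restr_sq mult.commute)
qed simp

lemma norm_restr_le_const:
  fixes v :: "real^'p"
  assumes "\<And>j. j \<in> T \<Longrightarrow> \<bar>v $ j\<bar> \<le> c" and "card T \<le> m" and "0 \<le> c"
  shows "norm (restr T v) \<le> sqrt (real m) * c"
proof (rule power2_le_imp_le)
  have "(norm (restr T v))\<^sup>2 \<le> (\<Sum>j\<in>T. c\<^sup>2)"
    unfolding norm_restr_sq using assms
    by (intro sum_mono) (metis abs_ge_zero power2_abs power_mono)
  also have "\<dots> \<le> real m * c\<^sup>2"
    using assms by (simp add: mult_right_mono)
  finally show "(norm (restr T v))\<^sup>2 \<le> (sqrt (real m) * c)\<^sup>2"
    by (simp add: power_mult_distrib)
qed (use assms in simp)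

lemma abs_inner_le_const_l1norm:
  fixes v z :: "real^'p"
  assumes "\<And>j. \<bar>z $ j\<bar> \<le> c"
  shows "\<bar>z \<bullet> v\<bar> \<le> c * l1norm v"
proof -
  have "\<bar>z \<bullet> v\<bar> \<le> (\<Sum>j\<in>UNIV. \<bar>z $ j * v $ j\<bar>)"
    unfolding inner_vec_def by (simp add: sum_abs)
  also have "\<dots> \<le> (\<Sum>j\<in>UNIV. c * \<bar>v $ j\<bar>)"
    using assms by (intro sum_mono) (simp add: abs_mult mult_right_mono)
  finally show ?thesis by (simp add: l1norm_def sum_distrib_left)
qed

lemma ex_top_coordinates:
  fixes v :: "real^'p"
  assumes "m \<le> card (supp v)"
  obtains T where "T \<subseteq> supp v" "card T = m" "\<And>j k. j \<in> T \<Longrightarrow> k \<notin> T \<Longrightarrow> \<bar>v $ k\<bar> \<le> \<bar>v $ j\<bar>"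
  using assms
proof (induction m arbitrary: thesis)
  case 0
  show ?case by (rule 0(1)[of "{}"]) auto
next
  case (Suc m)
  obtain T where T: "T \<subseteq> supp v" "card T = m" "\<And>j k. j \<in> T \<Longrightarrow> k \<notin> T \<Longrightarrow> \<bar>v $ k\<bar> \<le> \<bar>v $ j\<bar>"
    using Suc.IH Suc.prems(2) by (metis Suc_leD)
  have "supp v - T \<noteq> {}"
    using T(1,2) Suc.prems(2) by (metis Diff_eq_empty_iff Suc_n_not_le_n subset_antisym)
  then have "Max ((\<lambda>j. \<bar>v $ j\<bar>) ` (supp v - T)) \<in> (\<lambda>j. \<bar>v $ j\<bar>) ` (supp v - T)"
    by (intro Max_in) auto
  then obtain k where k: "k \<in> supp v - T" "Max ((\<lambda>j. \<bar>v $ j\<bar>) ` (supp v - T)) = \<bar>v $ k\<bar>"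
    by blast
  have k_max: "\<bar>v $ j\<bar> \<le> \<bar>v $ k\<bar>" if "j \<in> supp v - T" for j
    unfolding k(2)[symmetric] using that by (intro Max_ge) auto
  show ?case
  proof (rule Suc.prems(1)[of "insert k T"])
    show "insert k T \<subseteq> supp v" "card (insert k T) = Suc m"
      using k(1) T by auto
    fix i j assume "i \<in> insert k T" "j \<notin> insert k T"
    then show "\<bar>v $ j\<bar> \<le> \<bar>v $ i\<bar>"
      using k(1) k_max T(3) by (cases "j \<in> supp v") (auto simp: supp_def)
  qed
qed

text \<open>Peel off the \<open>m\<close> largest coordinates repeatedly. Every block but the first has entries
  bounded by the average of the preceding block, so its Euclidean norm is at most \<open>1 / sqrt m\<close>
  times the \<open>l1\<close> norm of that preceding block; the bounds telescope into \<open>l1norm w\<close>. The first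
  block \<open>T\<close> is fixed before \<open>q\<close> is, since one of the functionals to which this is applied depends
  on \<open>T\<close>.\<close>

lemma shelling:
  fixes w :: "real^'p"
  assumes "0 < m"
  shows "\<exists>T. T \<subseteq> supp w \<and> card T \<le> m \<and>
    (\<forall>q c. 0 \<le> c \<longrightarrow> q 0 = 0 \<longrightarrow> (\<forall>v v'. q (v + v') \<le> q v + q v') \<longrightarrow>
       (\<forall>v. supp v \<subseteq> supp w - T \<longrightarrow> card (supp v) \<le> m \<longrightarrow> q v \<le> c * norm v) \<longrightarrow>
       q (w - restr T w) \<le> c * (l1norm w / sqrt (real m)))"
proof (induction "card (supp w)" arbitrary: w rule: less_induct)
  case less
  show ?case
  proof (cases "card (supp w) \<le> m")
    case True
    then show ?thesis
      by (intro exI[of _ "supp w"]) (auto simp: restr_eq_self l1norm_nonneg)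
  next
    case False
    then obtain T where T: "T \<subseteq> supp w" "card T = m"
        "\<And>j k. j \<in> T \<Longrightarrow> k \<notin> T \<Longrightarrow> \<bar>w $ k\<bar> \<le> \<bar>w $ j\<bar>"
      using ex_top_coordinates[of m w] by auto
    define w' where "w' = restr (- T) w"
    have w': "w - restr T w = w'"
      by (simp add: w'_def vec_eq_iff)
    have supp': "supp w' = supp w - T"
      by (auto simp: w'_def supp_restr)
    have "card (supp w') < card (supp w)"
      unfolding supp' using T(1,2) assms False by (simp add: card_Diff_subset)
    from less[OF this] obtain T' where T': "T' \<subseteq> supp w'" "card T' \<le> m" and
      shell: "\<And>q c. 0 \<le> c \<Longrightarrow> q 0 = 0 \<Longrightarrow> (\<And>v v'. q (v + v') \<le> q v + q v') \<Longrightarrow>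
       (\<And>v. supp v \<subseteq> supp w' - T' \<Longrightarrow> card (supp v) \<le> m \<Longrightarrow> q v \<le> c * norm v) \<Longrightarrow>
       q (w' - restr T' w') \<le> c * (l1norm w' / sqrt (real m))"
      by blast
    have block: "norm (restr T' w') \<le> l1norm (restr T w) / sqrt (real m)"
    proof -
      have "norm (restr T' w') \<le> sqrt (real m) * (l1norm (restr T w) / real m)"
      proof (rule norm_restr_le_const[OF _ T'(2)])
        fix j assume "j \<in> T'"
        then have "j \<notin> T" using T'(1) supp' by auto
        then have "(\<Sum>i\<in>T. \<bar>w $ j\<bar>) \<le> (\<Sum>i\<in>T. \<bar>w $ i\<bar>)"
          by (intro sum_mono T(3))
        then show "\<bar>w' $ j\<bar> \<le> l1norm (restr T w) / real m"
          using assms T(2) \<open>j \<notin> T\<close> by (simp add: l1norm_restr w'_def field_simps)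
      qed (simp add: l1norm_nonneg)
      also have "\<dots> = l1norm (restr T w) * (sqrt (real m) / real m)"
        by simp
      also have "sqrt (real m) / real m = 1 / sqrt (real m)"
        using assms by (simp add: field_simps)
      finally show ?thesis by simp
    qed
    have "q (w - restr T w) \<le> c * (l1norm w / sqrt (real m))"
      if c: "0 \<le> c" and q: "q 0 = 0" "\<And>v v'. q (v + v') \<le> q v + q v'"
        and bound: "\<And>v. supp v \<subseteq> supp w - T \<Longrightarrow> card (supp v) \<le> m \<Longrightarrow> q v \<le> c * norm v" for q c
    proof -
      have "q w' \<le> q (restr T' w') + q (w' - restr T' w')"
        using q(2)[of "restr T' w'" "w' - restr T' w'"] by simp
      also have "q (restr T' w') \<le> c * norm (restr T' w')"
      proof (rule bound)
        show "supp (restr T' w') \<subseteq> supp w - T"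
          by (simp add: supp_restr supp' le_infI2)
        show "card (supp (restr T' w')) \<le> m"
          using T'(2) card_mono[of T' "T' \<inter> supp w'"] by (simp add: supp_restr)
      qed
      also have "\<dots> \<le> c * (l1norm (restr T w) / sqrt (real m))"
        using block c by (rule mult_left_mono)
      also have "q (w' - restr T' w') \<le> c * (l1norm w' / sqrt (real m))"
        using c q by (rule shell) (use bound supp' in auto)
      also have "c * (l1norm (restr T w) / sqrt (real m)) + c * (l1norm w' / sqrt (real m))
          = c * (l1norm w / sqrt (real m))"
        using l1norm_split[of w T] by (simp add: w'_def flip: distrib_left add_divide_distrib)
      finally show ?thesis by (simp add: w')
    qed
    then show ?thesis
      using T by (intro exI[of _ T]) auto
  qed
qed


section \<open>The prediction norm and the design constants\<close>

definition pnorm :: "real^'p^'n \<Rightarrow> real^'p \<Rightarrow> real" where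
  "pnorm X v = norm (X *v v) / sqrt (real CARD('n))"

lemma pnorm_nonneg [simp]: "0 \<le> pnorm X v"
  by (simp add: pnorm_def)

lemma pnorm_zero [simp]: "pnorm X 0 = 0"
  by (simp add: pnorm_def)

lemma pnorm_sq: "(pnorm X v)\<^sup>2 = (norm (X *v v))\<^sup>2 / real CARD('n)" for X :: "real^'p^'n"
  by (simp add: pnorm_def power_divide)

lemma pnorm_add_le: "pnorm X (v + w) \<le> pnorm X v + pnorm X w"
  by (simp add: pnorm_def matrix_vector_right_distrib norm_triangle_ineq divide_right_mono
      flip: add_divide_distrib)

lemma abs_inner_le_pnorm:
  fixes X :: "real^'p^'n"
  shows "\<bar>(X *v v) \<bullet> (X *v w)\<bar> / real CARD('n) \<le> pnorm X v * pnorm X w"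
  using Cauchy_Schwarz_ineq2[of "X *v v" "X *v w"]
  by (simp add: pnorm_def divide_right_mono)

lemma ex_pnorm_le_norm: "\<exists>C\<ge>0. \<forall>v. pnorm X v \<le> C * norm v" for X :: "real^'p^'n"
proof -
  obtain C where "C > 0" "\<And>v. norm (X *v v) \<le> norm v * C"
    using bounded_linear.pos_bounded[OF matrix_vector_mul_bounded_linear[of X]] by blast
  then show ?thesis
    by (intro exI[of _ "C / sqrt (real CARD('n))"])
      (simp add: pnorm_def divide_right_mono mult.commute)
qed

lemma sparse_quotients_pnorm:
  "sparse_quotients X m = {(pnorm X v)\<^sup>2 / (norm v)\<^sup>2 | v. v \<noteq> 0 \<and> card (supp v) \<le> m}"
  by (simp add: sparse_quotients_def pnorm_sq)

lemma sparse_quotients_bdd_above: "bdd_above (sparse_quotients X m)"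
proof -
  obtain C where C: "C \<ge> 0" "\<And>v. pnorm X v \<le> C * norm v"
    using ex_pnorm_le_norm by blast
  have "(pnorm X v)\<^sup>2 / (norm v)\<^sup>2 \<le> C\<^sup>2" if "v \<noteq> 0" for v
    using power_mono[OF C(2)[of v] pnorm_nonneg, of 2] that
    by (simp add: power_mult_distrib divide_le_eq)
  then show ?thesis
    unfolding bdd_above_def sparse_quotients_pnorm by blast
qed

lemma sparse_quotients_bdd_below: "bdd_below (sparse_quotients X m)"
  unfolding bdd_below_def sparse_quotients_pnorm by (intro exI[of _ 0]) auto

lemma sparse_quotients_nonempty:
  fixes X :: "real^'p^'n"
  assumes "0 < m"
  shows "sparse_quotients X m \<noteq> {}"
proof -
  have "supp (axis j 1 :: real^'p) = {j}" for j :: 'p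
    by (auto simp: supp_def axis_def)
  then have "axis undefined 1 \<noteq> (0 :: real^'p)" "card (supp (axis undefined 1 :: real^'p)) \<le> m"
    using assms by (auto simp: axis_eq_0_iff)
  then show ?thesis
    unfolding sparse_quotients_def by blast
qed

lemma pnorm_sq_le_Lmax:
  assumes "card (supp v) \<le> m"
  shows "(pnorm X v)\<^sup>2 \<le> Lmax X m * (norm v)\<^sup>2"
proof (cases "v = 0")
  case False
  then have "card (supp v) \<noteq> 0"
    using supp_nonempty_iff[of v] by simp
  then have "m \<noteq> 0"
    using assms by linarith
  have "(pnorm X v)\<^sup>2 / (norm v)\<^sup>2 \<le> Sup (sparse_quotients X m)"
    using assms False by (intro cSup_upper sparse_quotients_bdd_above)
      (auto simp: sparse_quotients_pnorm)
  then show ?thesis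
    using False \<open>m \<noteq> 0\<close> by (simp add: Lmax_def divide_le_eq)
qed simp

lemma Lmin_le_pnorm_sq:
  assumes "card (supp v) \<le> m"
  shows "Lmin X m * (norm v)\<^sup>2 \<le> (pnorm X v)\<^sup>2"
proof (cases "v = 0")
  case False
  have "Lmin X m \<le> (pnorm X v)\<^sup>2 / (norm v)\<^sup>2"
    unfolding Lmin_def using assms False by (intro cInf_lower sparse_quotients_bdd_below)
      (auto simp: sparse_quotients_pnorm)
  then show ?thesis
    using False by (simp add: le_divide_eq)
qed simp

lemma Lmax_nonneg: "0 \<le> Lmax X m"
proof (cases "m = 0")
  case False
  then obtain x where "x \<in> sparse_quotients X m"
    using sparse_quotients_nonempty[of m X] by auto
  moreover from this have "0 \<le> x"
    by (auto simp: sparse_quotients_pnorm)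
  ultimately show ?thesis
    using False cSup_upper[OF _ sparse_quotients_bdd_above] by (fastforce simp: Lmax_def)
qed (simp add: Lmax_def)

lemma Lmin_antimono: "0 < m \<Longrightarrow> m \<le> m' \<Longrightarrow> Lmin X m' \<le> Lmin X m"
  unfolding Lmin_def
  by (intro cInf_superset_mono sparse_quotients_nonempty sparse_quotients_bdd_below)
    (auto simp: sparse_quotients_def)

text \<open>The \<open>LEAST\<close> over the reals in \<open>restr_orth\<close> is meaningful because the admissible constants
  form a nonempty closed set that is bounded below; the lower bound \<open>0\<close> comes from two disjoint
  nonempty index sets.\<close>

lemma restr_orth_bound:
  fixes X :: "real^'p^'n"
  assumes "2 \<le> CARD('p)" "0 < m" "0 < m'"
  shows "0 \<le> restr_orth X m m'"
    and "supp v \<inter> supp v' = {} \<Longrightarrow> card (supp v) \<le> m \<Longrightarrow> card (supp v') \<le> m' \<Longrightarrow>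
      \<bar>(X *v v) \<bullet> (X *v v')\<bar> / real CARD('n) \<le> restr_orth X m m' * norm v * norm v'"
proof -
  define P where "P c \<longleftrightarrow> (\<forall>T T' v v'. T \<inter> T' = {} \<and> card T \<le> m \<and> card T' \<le> m' \<longrightarrow>
        \<bar>(X *v restr T v) \<bullet> (X *v restr T' v')\<bar> / real CARD('n)
          \<le> c * norm (restr T v) * norm (restr T' v'))" for c
  obtain C where C: "C \<ge> 0" "\<And>v. pnorm X v \<le> C * norm v"
    using ex_pnorm_le_norm by blast
  have "P (C * C)"
    unfolding P_def
  proof (intro allI impI)
    fix T T' :: "'p set" and v v' :: "real^'p"
    have "\<bar>(X *v restr T v) \<bullet> (X *v restr T' v')\<bar> / real CARD('n)
        \<le> pnorm X (restr T v) * pnorm X (restr T' v')"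
      by (rule abs_inner_le_pnorm)
    also have "\<dots> \<le> (C * norm (restr T v)) * (C * norm (restr T' v'))"
      using C by (intro mult_mono) auto
    finally show "\<bar>(X *v restr T v) \<bullet> (X *v restr T' v')\<bar> / real CARD('n)
        \<le> C * C * norm (restr T v) * norm (restr T' v')"
      by (simp add: mult_ac)
  qed
  then have nonempty: "{c. P c} \<noteq> {}" by blast
  have nonneg: "0 \<le> c" if "P c" for c
  proof -
    obtain i j :: 'p where "i \<noteq> j"
      using assms(1) by (metis card_2_iff' card_le_Suc0_iff_eq finite_class.finite_UNIV
          UNIV_I not_less_eq_eq numeral_2_eq_2)
    moreover have "restr {k} (axis k 1) = (axis k 1 :: real^'p)" for k
      by (auto simp: vec_eq_iff axis_def)
    ultimately have "\<bar>(X *v axis i 1) \<bullet> (X *v axis j 1)\<bar> / real CARD('n)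
        \<le> c * norm (axis i 1 :: real^'p) * norm (axis j 1 :: real^'p)"
      using that[unfolded P_def, rule_format, of "{i}" "{j}" "axis i 1" "axis j 1"] assms by auto
    then have "\<bar>(X *v axis i 1) \<bullet> (X *v axis j 1)\<bar> / real CARD('n) \<le> c"
      by simp
    then show ?thesis by (rule order_trans[rotated]) simp
  qed
  have bdd: "bdd_below {c. P c}"
    using nonneg by (intro bdd_belowI[of _ 0]) auto
  define c0 where "c0 = Inf {c. P c}"
  have "P c0"
    unfolding P_def
  proof (intro allI impI)
    fix T T' :: "'p set" and v v' :: "real^'p"
    assume T: "T \<inter> T' = {} \<and> card T \<le> m \<and> card T' \<le> m'"
    let ?x = "\<bar>(X *v restr T v) \<bullet> (X *v restr T' v')\<bar> / real CARD('n)"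
    let ?y = "norm (restr T v) * norm (restr T' v')"
    have le: "?x \<le> c * ?y" if "P c" for c
      using that T unfolding P_def by (auto simp: mult.assoc)
    show "?x \<le> c0 * norm (restr T v) * norm (restr T' v')"
    proof (cases "?y = 0")
      case True
      then show ?thesis
        by auto
    next
      case False
      then have "0 < ?y" by (simp add: zero_less_mult_iff)
      then have "?x / ?y \<le> c0"
        unfolding c0_def using le by (intro cInf_greatest nonempty) (simp only: pos_divide_le_eq mem_Collect_eq)
      then show ?thesis
        using \<open>0 < ?y\<close> by (simp only: pos_divide_le_eq mult.assoc)
    qed
  qed
  moreover have "restr_orth X m m' = c0"
    unfolding restr_orth_def P_def[symmetric]
    using \<open>P c0\<close> bdd c0_def by (intro Least_equality) (auto intro: cInf_lower)
  ultimately have P: "P (restr_orth X m m')" by simp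
  then show "0 \<le> restr_orth X m m'" by (rule nonneg)
  show "\<bar>(X *v v) \<bullet> (X *v v')\<bar> / real CARD('n) \<le> restr_orth X m m' * norm v * norm v'"
    if "supp v \<inter> supp v' = {}" "card (supp v) \<le> m" "card (supp v') \<le> m'"
    using P[unfolded P_def, rule_format, of "supp v" "supp v'" v v'] that
    by (simp add: restr_eq_self)
qed

text \<open>Expanding the squared norms of \<open>v / norm v \<plusminus> w / norm w\<close>, two vectors of squared length
  \<open>2\<close>: cross terms are controlled by the spread of the sparse eigenvalues.\<close>

lemma inner_le_eigenvalue_spread:
  fixes X :: "real^'p^'n"
  assumes disj: "supp v \<inter> supp w = {}" and card: "card (supp v \<union> supp w) \<le> m"
  shows "(X *v v) \<bullet> (X *v w) / real CARD('n) \<le> (Lmax X m - Lmin X m) / 2 * norm v * norm w"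
proof (cases "v = 0 \<or> w = 0")
  case False
  define v' w' where "v' = v /\<^sub>R norm v" and "w' = w /\<^sub>R norm w"
  have unit: "norm v' = 1" "norm w' = 1"
    using False by (auto simp: v'_def w'_def)
  have "v' \<bullet> w' = 0"
    unfolding inner_vec_def using disj
    by (intro sum.neutral) (auto simp: v'_def w'_def supp_def)
  then have len: "(norm (v' + w'))\<^sup>2 = 2" "(norm (v' - w'))\<^sup>2 = 2"
    using unit by (simp_all add: power2_norm_eq_inner inner_diff_left inner_diff_right
        inner_add_left inner_add_right inner_commute norm_eq_1)
  have sparse: "card (supp (v' + w')) \<le> m" "card (supp (v' - w')) \<le> m"
    by (rule order_trans[OF card_mono card]; force simp: v'_def w'_def supp_def)+
  have "4 * ((X *v v') \<bullet> (X *v w')) = (norm (X *v (v' + w')))\<^sup>2 - (norm (X *v (v' - w')))\<^sup>2"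
    by (simp add: matrix_vector_right_distrib matrix_vector_mult_diff_distrib power2_norm_eq_inner
        inner_diff_left inner_diff_right inner_add_left inner_add_right inner_commute)
  then have "4 * ((X *v v') \<bullet> (X *v w') / real CARD('n))
      = (pnorm X (v' + w'))\<^sup>2 - (pnorm X (v' - w'))\<^sup>2"
    by (simp add: pnorm_sq diff_divide_distrib)
  also have "\<dots> \<le> Lmax X m * 2 - Lmin X m * 2"
    using pnorm_sq_le_Lmax[OF sparse(1), of X] Lmin_le_pnorm_sq[OF sparse(2), of X] len by simp
  finally have "(X *v v') \<bullet> (X *v w') / real CARD('n) \<le> (Lmax X m - Lmin X m) / 2"
    by simp
  then have "norm v * norm w * ((X *v v') \<bullet> (X *v w') / real CARD('n))
      \<le> norm v * norm w * ((Lmax X m - Lmin X m) / 2)"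
    by (rule mult_left_mono) simp
  moreover have "norm v * norm w * ((X *v v') \<bullet> (X *v w')) = (X *v v) \<bullet> (X *v w)"
  proof -
    have "(X *v v) \<bullet> (X *v w) = (X *v (norm v *\<^sub>R v')) \<bullet> (X *v (norm w *\<^sub>R w'))"
      using False by (simp add: v'_def w'_def)
    then show ?thesis by (simp add: matrix_vector_mult_scaleR)
  qed
  ultimately have "((X *v v) \<bullet> (X *v w)) / real CARD('n) \<le> norm v * norm w * ((Lmax X m - Lmin X m) / 2)"
    by (metis times_divide_eq_right)
  then show ?thesis
    by (simp only: mult_ac)
qed auto

lemma RE_quotients_bdd_below: "bdd_below (RE_quotients X m k)"
  unfolding bdd_below_def RE_quotients_def by (intro exI[of _ 0]) auto

lemma RE_quotients_nonempty:
  fixes X :: "real^'p^'n"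
  assumes "0 < m" "0 \<le> k"
  shows "RE_quotients X m k \<noteq> {}"
proof -
  have "l1norm (restr (- {j}) (axis j 1 :: real^'p)) = 0" for j :: 'p
    by (simp add: l1norm_restr axis_def)
  then have "card {undefined::'p} \<le> m \<and> axis undefined 1 \<noteq> (0 :: real^'p) \<and>
     l1norm (restr (- {undefined}) (axis undefined 1 :: real^'p))
       \<le> k * l1norm (restr {undefined} (axis undefined 1))"
    using assms by (simp add: l1norm_nonneg)
  then show ?thesis
    unfolding RE_quotients_def by blast
qed

lemma RE_mono:
  assumes "RE X m k" "0 < k'" "k' \<le> k"
  shows "RE X m k'"
proof -
  have "l1norm (restr (- J) v) \<le> k * l1norm (restr J v)"
    if "l1norm (restr (- J) v) \<le> k' * l1norm (restr J v)" for J and v :: "real^'a"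
    using that mult_right_mono[OF assms(3) l1norm_nonneg[of "restr J v"]] by linarith
  then have "RE_quotients X m k' \<subseteq> RE_quotients X m k"
    unfolding RE_quotients_def by blast
  then have "Inf (RE_quotients X m k) \<le> Inf (RE_quotients X m k')"
    using assms by (intro cInf_superset_mono RE_quotients_nonempty RE_quotients_bdd_below)
      (auto simp: RE_def)
  then show ?thesis
    using assms by (auto simp: RE_def)
qed

lemma REK_pos: "RE X m k \<Longrightarrow> 0 < REK X m k"
  by (simp add: RE_def REK_def)

lemma RE_bound:
  fixes X :: "real^'p^'n"
  assumes RE: "RE X m k" and J: "card J \<le> m" and cone: "l1norm (restr (- J) v) \<le> k * l1norm (restr J v)"
  shows "norm (restr J v) \<le> REK X m k * pnorm X v"
proof (cases "restr J v = 0")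
  case True
  then show ?thesis
    using REK_pos[OF RE] by simp
next
  case False
  then have "v \<noteq> 0" by (metis restr_nth vec_eq_iff zero_index)
  have "Inf (RE_quotients X m k) \<le> norm (X *v v) / (sqrt (real CARD('n)) * norm (restr J v))"
    using J cone \<open>v \<noteq> 0\<close> by (intro cInf_lower RE_quotients_bdd_below) (auto simp: RE_quotients_def)
  then have "Inf (RE_quotients X m k) * norm (restr J v) \<le> pnorm X v"
    using False by (simp add: pnorm_def field_simps)
  then show ?thesis
    using RE by (simp add: REK_def RE_def field_simps)
qed

text \<open>A \<open>2m\<close>-sparse vector lies in the cone of its \<open>m\<close> largest coordinates, which carry at
  least half of its squared length.\<close>

lemma Lmin_ge_RE:
  fixes X :: "real^'p^'n"
  assumes RE: "RE X m k" and "1 \<le> k"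
  shows "1 \<le> 2 * (REK X m k)\<^sup>2 * Lmin X (2 * m)"
proof -
  have "0 < m" using RE by (auto simp: RE_def)
  note K = REK_pos[OF RE]
  have half: "(norm v)\<^sup>2 \<le> 2 * (REK X m k)\<^sup>2 * (pnorm X v)\<^sup>2" if v: "card (supp v) \<le> 2 * m" for v
  proof -
    obtain J where J: "J \<subseteq> supp v" "card J = min m (card (supp v))"
        "\<And>j i. j \<in> J \<Longrightarrow> i \<notin> J \<Longrightarrow> \<bar>v $ i\<bar> \<le> \<bar>v $ j\<bar>"
      using ex_top_coordinates[of "min m (card (supp v))" v] by auto
    have "card (supp v - J) \<le> card J"
      using J(1,2) v by (simp add: card_Diff_subset)
    then obtain f where f: "f ` (supp v - J) \<subseteq> J" "inj_on f (supp v - J)"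
      using card_le_inj[of "supp v - J" J] by auto
    have compare: "(\<Sum>i\<in>- J. g \<bar>v $ i\<bar>) \<le> (\<Sum>j\<in>J. g \<bar>v $ j\<bar>)"
      if g: "g 0 = 0" "\<And>x y. 0 \<le> x \<Longrightarrow> x \<le> y \<Longrightarrow> g x \<le> g y" for g :: "real \<Rightarrow> real"
    proof -
      have "(\<Sum>i\<in>- J. g \<bar>v $ i\<bar>) = (\<Sum>i\<in>supp v - J. g \<bar>v $ i\<bar>)"
        by (rule sum.mono_neutral_right) (auto simp: supp_def g(1))
      also have "\<dots> \<le> (\<Sum>i\<in>supp v - J. g \<bar>v $ f i\<bar>)"
        using f by (intro sum_mono g(2) J(3)) auto
      also have "\<dots> = (\<Sum>j\<in>f ` (supp v - J). g \<bar>v $ j\<bar>)"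
        using f by (simp add: sum.reindex)
      also have "\<dots> \<le> (\<Sum>j\<in>J. g \<bar>v $ j\<bar>)"
        using f g(2)[of 0] g(1) by (intro sum_mono2) auto
      finally show ?thesis .
    qed
    have "l1norm (restr (- J) v) \<le> 1 * l1norm (restr J v)"
      using compare[of "\<lambda>x. x"] by (simp add: l1norm_restr)
    also have "\<dots> \<le> k * l1norm (restr J v)"
      using \<open>1 \<le> k\<close> by (intro mult_right_mono l1norm_nonneg)
    finally have "norm (restr J v) \<le> REK X m k * pnorm X v"
      using J by (intro RE_bound[OF RE]) auto
    then have "(norm (restr J v))\<^sup>2 \<le> (REK X m k)\<^sup>2 * (pnorm X v)\<^sup>2"
      using power_mono[OF _ norm_ge_zero, of "restr J v" _ 2] by (fastforce simp add: power_mult_distrib)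
    moreover have "(norm (restr (- J) v))\<^sup>2 \<le> (norm (restr J v))\<^sup>2"
      using compare[of "\<lambda>x. x\<^sup>2"] by (simp add: norm_restr_sq power_mono)
    ultimately show ?thesis
      using norm_sq_split[of v J] by linarith
  qed
  have "1 / (2 * (REK X m k)\<^sup>2) \<le> Lmin X (2 * m)"
    unfolding Lmin_def
  proof (rule cInf_greatest)
    show "sparse_quotients X (2 * m) \<noteq> {}"
      using \<open>0 < m\<close> by (intro sparse_quotients_nonempty) simp
    fix x assume "x \<in> sparse_quotients X (2 * m)"
    then obtain v where v: "x = (pnorm X v)\<^sup>2 / (norm v)\<^sup>2" "v \<noteq> 0" "card (supp v) \<le> 2 * m"
      unfolding sparse_quotients_pnorm by blast
    then have "1 \<le> 2 * (REK X m k)\<^sup>2 * (pnorm X v)\<^sup>2 / (norm v)\<^sup>2"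
      using half[of v] by simp
    then show "1 / (2 * (REK X m k)\<^sup>2) \<le> x"
      using K v(1) by (simp add: divide_le_eq mult_ac)
  qed
  then show ?thesis
    using K by (simp add: field_simps)
qed


section \<open>Lasso estimates on the noise event\<close>

text \<open>First-order optimality: compare \<open>b\<close> with the points \<open>b + t (c - b)\<close>, use convexity of the
  penalty, and let \<open>t\<close> tend to \<open>0\<close>. Comparing with \<open>c\<close> itself would lose half of the
  quadratic term \<open>(norm (X *v (b - c)))\<^sup>2\<close>.\<close>

lemma lasso_variational:
  fixes X :: "real^'p^'n"
  assumes opt: "is_arg_min (lasso_objective X y l) (\<lambda>_. True) b" and "0 \<le> l"
  shows "l * (l1norm b - l1norm c) \<le> ((y - X *v b) \<bullet> (X *v (b - c))) / real CARD('n)"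
proof -
  define r z where "r = y - X *v b" and "z = X *v (b - c)"
  define N where "N = real CARD('n)"
  have "N > 0" by (simp add: N_def)
  have step: "l * (l1norm b - l1norm c) \<le> (r \<bullet> z) / N + t * ((norm z)\<^sup>2 / (2 * N))"
    if t: "0 < t" "t \<le> 1" for t
  proof -
    define b' where "b' = b + t *\<^sub>R (c - b)"
    have "lasso_objective X y l b \<le> lasso_objective X y l b'"
      using opt by (simp add: is_arg_min_linorder)
    moreover
    have eq: "y - X *v b' = r + t *\<^sub>R z"
      by (simp add: b'_def r_def z_def matrix_vector_right_distrib matrix_vector_mult_scaleR
          matrix_vector_mult_diff_distrib algebra_simps)
    have "(norm (y - X *v b'))\<^sup>2 = (norm r)\<^sup>2 + 2 * t * (r \<bullet> z) + t\<^sup>2 * (norm z)\<^sup>2"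
      unfolding eq power2_norm_eq_inner by (simp add: inner_add_left inner_add_right inner_commute
          power2_eq_square)
    moreover have "b' = (1 - t) *\<^sub>R b + t *\<^sub>R c"
      by (simp add: b'_def algebra_simps)
    then have "l1norm b' \<le> (1 - t) * l1norm b + t * l1norm c"
      using l1norm_add_le[of "(1 - t) *\<^sub>R b" "t *\<^sub>R c"] t by (simp add: l1norm_scaleR)
    then have "l * l1norm b' \<le> l * ((1 - t) * l1norm b + t * l1norm c)"
      using \<open>0 \<le> l\<close> by (rule mult_left_mono)
    ultimately have "l * l1norm b - l * ((1 - t) * l1norm b + t * l1norm c)
        \<le> 1 / (2 * N) * ((norm r)\<^sup>2 + 2 * t * (r \<bullet> z) + t\<^sup>2 * (norm z)\<^sup>2) - 1 / (2 * N) * (norm r)\<^sup>2"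
      by (simp only: lasso_objective_def r_def[symmetric] N_def[symmetric])
    also have "\<dots> = t * ((r \<bullet> z) / N + t * ((norm z)\<^sup>2 / (2 * N)))"
      using \<open>N > 0\<close> by (simp add: field_simps power2_eq_square)
    finally have "t * (l * (l1norm b - l1norm c))
        \<le> t * ((r \<bullet> z) / N + t * ((norm z)\<^sup>2 / (2 * N)))"
      by (simp add: algebra_simps)
    then show ?thesis
      using t by simp
  qed
  have "((\<lambda>t. (r \<bullet> z) / N + t * ((norm z)\<^sup>2 / (2 * N))) \<longlongrightarrow> (r \<bullet> z) / N + 0 * ((norm z)\<^sup>2 / (2 * N)))
      (at_right 0)"
    by (intro tendsto_intros)
  moreover have "\<forall>\<^sub>F t in at_right 0. l * (l1norm b - l1norm c)
      \<le> (r \<bullet> z) / N + t * ((norm z)\<^sup>2 / (2 * N))"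
    unfolding eventually_at_right_field using step by (auto intro!: exI[of _ 1])
  ultimately have "l * (l1norm b - l1norm c) \<le> (r \<bullet> z) / N + 0 * ((norm z)\<^sup>2 / (2 * N))"
    by (rule tendsto_lowerbound) simp
  then show ?thesis
    by (simp add: r_def z_def N_def)
qed

text \<open>The reference point \<open>c\<close> need not be the truth: \<open>X *v d\<close> is the part of the signal that
  \<open>c\<close> leaves unexplained.\<close>

lemma lasso_basic_inequality:
  fixes X :: "real^'p^'n"
  assumes opt: "is_arg_min (lasso_objective X y l) (\<lambda>_. True) b" and "0 \<le> l"
    and y: "y = X *v (c + d) + e" and c: "supp c \<subseteq> T"
    and noise: "\<And>j. \<bar>(transpose X *v e) $ j\<bar> \<le> real CARD('n) * (l / 2)"
  shows "2 * (pnorm X (b - c))\<^sup>2 + l * l1norm (restr (- T) (b - c))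
    \<le> 2 * pnorm X (b - c) * pnorm X d + 3 * (l * l1norm (restr T (b - c)))"
proof -
  define h where "h = b - c"
  define N where "N = real CARD('n)"
  have "N > 0" by (simp add: N_def)
  have "y - X *v b = X *v d + e - X *v h"
    by (simp add: y h_def matrix_vector_right_distrib matrix_vector_mult_diff_distrib)
  then have "l * (l1norm b - l1norm c) \<le> ((X *v d + e - X *v h) \<bullet> (X *v h)) / N"
    using lasso_variational[OF opt \<open>0 \<le> l\<close>, of c] by (simp add: h_def N_def)
  also have "\<dots> = ((X *v h) \<bullet> (X *v d)) / N + (e \<bullet> (X *v h)) / N - (pnorm X h)\<^sup>2"
    by (simp add: pnorm_sq N_def inner_diff_left inner_add_left power2_norm_eq_inner
        add_divide_distrib diff_divide_distrib inner_commute[of "X *v h" "X *v d"])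
  also have "((X *v h) \<bullet> (X *v d)) / N \<le> pnorm X h * pnorm X d"
    using abs_inner_le_pnorm[of X h d] \<open>N > 0\<close>
    by (simp add: N_def) (smt (verit) divide_right_mono of_nat_0_le_iff)
  also have "(e \<bullet> (X *v h)) / N \<le> l / 2 * l1norm h"
  proof -
    have "e \<bullet> (X *v h) = (transpose X *v e) \<bullet> h"
      by (simp add: dot_lmul_matrix[symmetric] vector_transpose_matrix inner_commute
          transpose_matrix_vector)
    also have "\<dots> \<le> N * (l / 2) * l1norm h"
      using abs_inner_le_const_l1norm[of "transpose X *v e" "N * (l / 2)" h] noise
      by (simp add: N_def)
    finally show ?thesis
      using \<open>N > 0\<close> by (simp add: field_simps)
  qed
  finally have main: "l * (l1norm b - l1norm c)
      \<le> pnorm X h * pnorm X d + l / 2 * l1norm h - (pnorm X h)\<^sup>2" by simp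
  have "l1norm (restr (- T) h) - l1norm (restr T h) \<le> l1norm b - l1norm c"
  proof -
    have "c $ j = 0" if "j \<notin> T" for j
      using c that by (auto simp: supp_def)
    then have "restr T (- h) = c - restr T b" "restr (- T) h = restr (- T) b"
      by (auto simp: h_def vec_eq_iff)
    moreover have "l1norm (restr T (- h)) = l1norm (restr T h)"
      by (simp add: l1norm_restr)
    ultimately show ?thesis
      using l1norm_diff_le[of c "restr T b"] l1norm_split[of b T] by simp
  qed
  then have "l * (l1norm (restr (- T) h) - l1norm (restr T h)) \<le> l * (l1norm b - l1norm c)"
    using \<open>0 \<le> l\<close> by (rule mult_left_mono)
  then show ?thesis
    using main l1norm_split[of h T] unfolding h_def[symmetric] by (simp add: algebra_simps)
qed

text \<open>Write \<open>A\<close> and \<open>B\<close> for the prediction norms of the error and of the unexplained signal,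
  \<open>w\<close> and \<open>u\<close> for the scaled \<open>l1\<close> norms of the error on and off the reference support. A
  restricted eigenvalue condition supplies \<open>k3\<close> and \<open>k4\<close>, each for errors in its cone only. Outside
  both cones \<open>w\<close> is dominated by \<open>u\<close>, and the inequality \<open>basic\<close> alone bounds \<open>u\<close>.\<close>

lemma cone_case_analysis:
  fixes A B u w k3 k4 :: real
  assumes basic: "2 * A\<^sup>2 + u \<le> 2 * A * B + 3 * w"
    and nonneg: "0 \<le> A" "0 \<le> B" "0 \<le> u" "0 \<le> w" "0 \<le> k3" "0 \<le> k4"
    and cone3: "u \<le> 3 * w \<longrightarrow> w \<le> k3 * A"
    and cone4: "u \<le> 4 * w \<longrightarrow> w \<le> k4 * A"
  shows "u \<le> 3 * w \<Longrightarrow> u \<le> B\<^sup>2 + 9 / 4 * k3\<^sup>2 \<and> A \<le> B + 3 / 2 * k3"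
    and "3 * w < u \<Longrightarrow> u \<le> 4 * w \<Longrightarrow> A \<le> k4 \<Longrightarrow> u \<le> 4 * k4\<^sup>2"
    and "3 * w < u \<Longrightarrow> k4 < A \<or> 4 * w < u \<Longrightarrow> u \<le> 3 * B\<^sup>2 \<and> A \<le> B"
proof -
  show "u \<le> B\<^sup>2 + 9 / 4 * k3\<^sup>2 \<and> A \<le> B + 3 / 2 * k3" if "u \<le> 3 * w"
  proof
    have u: "2 * A\<^sup>2 + u \<le> 2 * A * B + 3 * (k3 * A)"
      using basic cone3[rule_format, OF that] by linarith
    \<comment> \<open>maximise the right-hand side over \<open>A\<close>, then separate \<open>B\<close> from \<open>k3\<close>\<close>
    have "B\<^sup>2 + 9 / 4 * k3\<^sup>2 - (2 * A * B + 3 * (k3 * A) - 2 * A\<^sup>2)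
        = 2 * (A - (B + 3 / 2 * k3) / 2)\<^sup>2 + (B - 3 / 2 * k3)\<^sup>2 / 2"
      by (simp add: power2_eq_square field_simps)
    also have "0 \<le> \<dots>"
      by simp
    finally show "u \<le> B\<^sup>2 + 9 / 4 * k3\<^sup>2"
      using u by linarith
    have "A * A \<le> A * (B + 3 / 2 * k3)"
      using u nonneg(3) by (simp add: power2_eq_square algebra_simps)
    then show "A \<le> B + 3 / 2 * k3"
      using nonneg by (cases "A = 0") auto
  qed
  show "u \<le> 4 * k4\<^sup>2" if "3 * w < u" "u \<le> 4 * w" "A \<le> k4"
    using cone4[rule_format, OF that(2)] mult_left_mono[OF that(3) nonneg(6)] that(2)
    by (simp add: power2_eq_square)
  show "u \<le> 3 * B\<^sup>2 \<and> A \<le> B" if "3 * w < u" "k4 < A \<or> 4 * w < u"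
  proof
    have "A * A < A * B"
      using basic that(1) by (simp add: power2_eq_square)
    then show "A \<le> B"
      using nonneg(1) by (metis less_eq_real_def mult_left_mono not_less)
    then have AB: "A * A \<le> A * B" "A * B \<le> B * B"
      using nonneg by (simp_all add: mult_left_mono mult_right_mono)
    show "u \<le> 3 * B\<^sup>2"
    proof (cases "4 * w < u")
      case True
      have "0 \<le> (B - 2 * A)\<^sup>2" by simp
      then have "u \<le> 2 * B\<^sup>2"
        using True basic by (simp add: power2_eq_square algebra_simps)
      then show ?thesis
        using zero_le_power2[of B] by linarith
    next
      case False
      then have "w \<le> k4 * A" "k4 < A"
        using cone4 that(2) by auto
      then have "w \<le> A * A"
        using nonneg(1) mult_right_mono[of k4 A A] by simp
      then show ?thesis
        using basic AB by (simp add: power2_eq_square algebra_simps)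
    qed
  qed
qed

text \<open>Split \<open>h\<close> off \<open>T\<close> into blocks by decreasing size. With \<open>U\<close> the union of \<open>T\<close> and the
  first block, \<open>X *v restr U h\<close> differs from \<open>X *v h\<close> by the remaining blocks; their
  contribution is bounded either by the triangle inequality or, after taking the inner product
  with \<open>X *v restr U h\<close>, by restricted orthogonality.\<close>

lemma norm_restr_le_prediction:
  fixes X :: "real^'p^'n"
  assumes "2 \<le> CARD('p)" and m: "0 < m" and T: "card T \<le> m" and pos: "0 < Lmin X (2 * m)"
  shows "sqrt (Lmin X (2 * m)) * norm (restr T h)
    \<le> pnorm X h + ell X m * (l1norm (restr (- T) h) / sqrt (real m))"
proof -
  define w where "w = restr (- T) h"
  define L where "L = l1norm w / sqrt (real m)"
  have "0 \<le> L" by (simp add: L_def l1norm_nonneg)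
  obtain T' where T': "T' \<subseteq> supp w" "card T' \<le> m" and
      shell: "\<And>q c. 0 \<le> c \<Longrightarrow> q 0 = 0 \<Longrightarrow> (\<And>v v'. q (v + v') \<le> q v + q v') \<Longrightarrow>
       (\<And>v. supp v \<subseteq> supp w - T' \<Longrightarrow> card (supp v) \<le> m \<Longrightarrow> q v \<le> c * norm v) \<Longrightarrow>
       q (w - restr T' w) \<le> c * L"
    using shelling[OF m, of w] unfolding L_def by blast
  define U where "U = T \<union> T'"
  define g where "g = restr U h"
  define k where "k = w - restr T' w"
  have "T \<inter> T' = {}"
    using T'(1) by (auto simp: w_def supp_restr)
  then have h: "h = g + k"
    by (auto simp: g_def k_def w_def U_def vec_eq_iff)
  have suppg: "supp g \<subseteq> U"
    by (auto simp: g_def supp_restr)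
  have "card (supp g) \<le> 2 * m"
    using card_mono[OF finite suppg] card_Un_le[of T T'] T T'(2) by (simp add: U_def)
  have disj: "supp g \<inter> (supp w - T') = {}"
    using suppg by (auto simp: U_def w_def supp_restr)
  define a where "a = sqrt (Lmin X (2 * m)) * norm g"
  have a: "a \<le> pnorm X g"
    unfolding a_def using Lmin_le_pnorm_sq[OF \<open>card (supp g) \<le> 2 * m\<close>, of X] pos
    by - (rule power2_le_imp_le, simp_all add: power_mult_distrib)
  have "0 \<le> a" by (simp add: a_def pos less_imp_le)
  have bound1: "a \<le> pnorm X h + sqrt (Lmax X m) * L"
  proof -
    have "pnorm X (- k) \<le> sqrt (Lmax X m) * L"
      unfolding k_def
    proof (rule shell[where q = "\<lambda>v. pnorm X (- v)"])
      fix v :: "real^'p" assume "card (supp v) \<le> m"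
      then have "(pnorm X (- v))\<^sup>2 \<le> (sqrt (Lmax X m) * norm v)\<^sup>2"
        using pnorm_sq_le_Lmax[of "- v" m X] by (simp add: power_mult_distrib Lmax_nonneg supp_def)
      then show "pnorm X (- v) \<le> sqrt (Lmax X m) * norm v"
        by (rule power2_le_imp_le) (simp add: Lmax_nonneg)
    next
      fix v v' :: "real^'p" show "pnorm X (- (v + v')) \<le> pnorm X (- v) + pnorm X (- v')"
        using pnorm_add_le[of X "- v" "- v'"] by simp
    qed (simp_all add: Lmax_nonneg)
    moreover have "pnorm X g \<le> pnorm X h + pnorm X (- k)"
      using pnorm_add_le[of X h "- k"] by (simp add: h)
    ultimately show ?thesis using a by simp
  qed
  define \<theta> where "\<theta> = restr_orth X m (2 * m)"
  have "0 \<le> \<theta>"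
    unfolding \<theta>_def using assms by (intro restr_orth_bound(1)) auto
  have bound2: "a \<le> pnorm X h + \<theta> / sqrt (Lmin X (2 * m)) * L"
  proof (cases "pnorm X g = 0")
    case True
    then have "a \<le> 0" using a by simp
    then show ?thesis
      using \<open>0 \<le> \<theta>\<close> \<open>0 \<le> L\<close> pos by (smt (verit) divide_nonneg_pos mult_nonneg_nonneg pnorm_nonneg real_sqrt_gt_zero)
  next
    case False
    then have "0 < pnorm X g"
      using pnorm_nonneg[of X g] by linarith
    define q where "q v = - ((X *v v) \<bullet> (X *v g)) / real CARD('n)" for v
    have "q k \<le> \<theta> * norm g * L"
      unfolding k_def
    proof (rule shell[where q = q])
      fix v :: "real^'p" assume v: "supp v \<subseteq> supp w - T'" "card (supp v) \<le> m"
      have "q v \<le> \<bar>(X *v v) \<bullet> (X *v g)\<bar> / real CARD('n)"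
        unfolding q_def by (intro divide_right_mono) auto
      also have "\<dots> \<le> \<theta> * norm v * norm g"
        unfolding \<theta>_def using v disj assms \<open>card (supp g) \<le> 2 * m\<close>
        by (intro restr_orth_bound(2)) auto
      finally show "q v \<le> \<theta> * norm g * norm v"
        by (simp add: mult_ac)
    qed (use \<open>0 \<le> \<theta>\<close> in \<open>auto simp: q_def matrix_vector_right_distrib inner_add_left
          add_divide_distrib diff_divide_distrib\<close>)
    moreover have "(pnorm X g)\<^sup>2 = ((X *v h) \<bullet> (X *v g)) / real CARD('n) + q k"
      by (simp add: pnorm_sq h q_def power2_norm_eq_inner matrix_vector_right_distrib
          inner_add_left flip: add_divide_distrib diff_divide_distrib)
    moreover have "((X *v h) \<bullet> (X *v g)) / real CARD('n) \<le> pnorm X h * pnorm X g"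
      using abs_inner_le_pnorm[of X h g] by (smt (verit) divide_right_mono of_nat_0_le_iff)
    ultimately have "(pnorm X g)\<^sup>2 \<le> pnorm X h * pnorm X g + \<theta> * norm g * L"
      by linarith
    also have "norm g = a / sqrt (Lmin X (2 * m))"
      using pos by (simp add: a_def)
    also have "\<theta> * (a / sqrt (Lmin X (2 * m))) * L
        \<le> \<theta> * (pnorm X g / sqrt (Lmin X (2 * m))) * L"
      using a \<open>0 \<le> \<theta>\<close> \<open>0 \<le> L\<close> pos by (intro mult_right_mono mult_left_mono divide_right_mono) auto
    finally have "pnorm X g * pnorm X g
        \<le> pnorm X g * (pnorm X h + \<theta> / sqrt (Lmin X (2 * m)) * L)"
      by (simp add: power2_eq_square algebra_simps)
    then have "pnorm X g \<le> pnorm X h + \<theta> / sqrt (Lmin X (2 * m)) * L"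
      using \<open>0 < pnorm X g\<close> by simp
    then show ?thesis using a by simp
  qed
  have "sqrt (Lmin X (2 * m)) * norm (restr T h) \<le> a"
    unfolding a_def g_def using pos by (intro mult_left_mono norm_restr_mono) (auto simp: U_def)
  also have "a \<le> pnorm X h + ell X m * L"
    using bound1 bound2 by (auto simp: ell_def \<theta>_def min_def)
  finally show ?thesis by (simp add: L_def w_def)
qed


lemma ell_nonneg:
  fixes X :: "real^'p^'n"
  assumes "2 \<le> CARD('p)" "0 < m" "0 < Lmin X (2 * m)"
  shows "0 \<le> ell X m"
  using assms restr_orth_bound(1)[of m "2 * m" X] by (simp add: ell_def Lmax_nonneg)

text \<open>Three regimes: the error lies in the cone with factor \<open>3\<close>; or only in the cone with
  factor \<open>4\<close>, with small prediction error; or the unexplained signal dominates, and then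
  \<open>norm_restr_le_prediction\<close> replaces the cone condition. The arguments of the maxima in the
  two constants come from these regimes.\<close>

lemma lasso_error_bounds:
  fixes X :: "real^'p^'n"
  assumes p: "2 \<le> CARD('p)"
    and opt: "is_arg_min (lasso_objective X y (d0 * \<tau>)) (\<lambda>_. True) b"
    and y: "y = X *v (c + d) + e" and c: "supp c \<subseteq> T" and T: "card T \<le> s0"
    and d: "card (supp d) \<le> s - s0" "norm d \<le> sqrt (real s0) * \<tau>"
    and noise: "\<And>j. \<bar>(transpose X *v e) $ j\<bar> \<le> real CARD('n) * (d0 * \<tau> / 2)"
    and RE: "RE X s0 4" and Lmin: "0 < Lmin X (2 * s0)" and "0 < d0" "0 < \<tau>"
  shows "norm (restr T (b - c)) \<le> D0'_const X s s0 d0 * (sqrt (real s0) * \<tau>)"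
    and "l1norm (restr (- T) (b - c)) \<le> D1_const X s s0 d0 * (real s0 * \<tau>)"
proof -
  define h \<rho> l \<Lambda> K3 K4 where "h = b - c" and "\<rho> = sqrt (real s0) * \<tau>" and "l = d0 * \<tau>"
    and "\<Lambda> = Lmax X (s - s0)" and "K3 = REK X s0 3" and "K4 = REK X s0 4"
  define A B where "A = pnorm X h" and "B = pnorm X d"
  define u w where "u = l * l1norm (restr (- T) h)" and "w = l * l1norm (restr T h)"
  define k3 k4 where "k3 = d0 * K3 * \<rho>" and "k4 = d0 * K4 * \<rho>"
  have s0: "0 < s0"
    using RE by (simp add: RE_def)
  have RE3: "RE X s0 3"
    using RE by (rule RE_mono) auto
  have K: "0 < K3" "0 < K4"
    using REK_pos[OF RE] REK_pos[OF RE3] by (auto simp: K3_def K4_def)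
  have pos: "0 < l" "0 < \<rho>" "0 \<le> \<Lambda>"
    using \<open>0 < d0\<close> \<open>0 < \<tau>\<close> s0 by (auto simp: l_def \<rho>_def \<Lambda>_def Lmax_nonneg)
  have B: "B \<le> sqrt \<Lambda> * \<rho>"
  proof (rule power2_le_imp_le)
    have "B\<^sup>2 \<le> \<Lambda> * (norm d)\<^sup>2"
      unfolding B_def \<Lambda>_def by (rule pnorm_sq_le_Lmax[OF d(1)])
    also have "\<dots> \<le> \<Lambda> * \<rho>\<^sup>2"
      using d(2) pos by (intro mult_left_mono power_mono) (auto simp: \<rho>_def)
    finally show "B\<^sup>2 \<le> (sqrt \<Lambda> * \<rho>)\<^sup>2"
      using pos by (simp add: power_mult_distrib)
  qed (use pos in simp)
  then have B2: "B\<^sup>2 \<le> \<Lambda> * \<rho>\<^sup>2"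
    using power_mono[of B _ 2] pos by (fastforce simp: B_def power_mult_distrib)
  have w: "w \<le> d0 * \<rho> * norm (restr T h)"
  proof -
    have "l1norm (restr T h) \<le> sqrt (real (card T)) * norm (restr T h)"
      by (rule l1norm_restr_le)
    also have "\<dots> \<le> sqrt (real s0) * norm (restr T h)"
      using T by (intro mult_right_mono) auto
    finally have "w \<le> l * (sqrt (real s0) * norm (restr T h))"
      unfolding w_def using pos by (intro mult_left_mono) auto
    then show ?thesis by (simp add: l_def \<rho>_def mult_ac)
  qed
  have cone: "norm (restr T h) \<le> REK X s0 k * A"
    if "RE X s0 k" "u \<le> k * w" for k
  proof -
    have "l * l1norm (restr (- T) h) \<le> l * (k * l1norm (restr T h))"
      using that(2) by (simp add: u_def w_def mult_ac)
    then show ?thesis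
      unfolding A_def using that(1) T pos by (intro RE_bound) auto
  qed
  have w_cone: "w \<le> d0 * REK X s0 k * \<rho> * A" if "RE X s0 k" "u \<le> k * w" for k
  proof -
    have "d0 * \<rho> * norm (restr T h) \<le> d0 * \<rho> * (REK X s0 k * A)"
      using cone[OF that] pos \<open>0 < d0\<close> by (intro mult_left_mono) auto
    then show ?thesis using w by (simp add: mult_ac)
  qed
  have basic: "2 * A\<^sup>2 + u \<le> 2 * A * B + 3 * w"
    using lasso_basic_inequality[OF opt _ y c noise] \<open>0 < d0\<close> \<open>0 < \<tau>\<close>
    by (simp add: A_def B_def u_def w_def h_def l_def)
  have nonneg: "0 \<le> A" "0 \<le> B" "0 \<le> u" "0 \<le> w" "0 \<le> k3" "0 \<le> k4"
    using pos K \<open>0 < d0\<close> by (auto simp: A_def B_def u_def w_def k3_def k4_def l1norm_nonneg)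
  have w3: "u \<le> 3 * w \<longrightarrow> w \<le> k3 * A"
    using w_cone[OF RE3] by (simp add: k3_def K3_def)
  have w4: "u \<le> 4 * w \<longrightarrow> w \<le> k4 * A"
    using w_cone[OF RE] by (simp add: k4_def K4_def)
  note cases = cone_case_analysis[OF basic nonneg w3 w4]
  define M1 M2 M3 where "M1 = \<Lambda> / d0\<^sup>2 + 9 / 4 * K3\<^sup>2" and "M2 = 4 * K4\<^sup>2" and "M3 = 3 * \<Lambda> / d0\<^sup>2"
  define N1 N2 N3 where "N1 = K3 * sqrt \<Lambda> + 3 * d0 * K3\<^sup>2" and "N2 = d0 * K4\<^sup>2"
    and "N3 = D_const X s s0 d0"
  have D0': "D0'_const X s s0 d0 = max N3 (max N2 N1)"
    by (simp add: D0'_const_def N1_def N2_def N3_def K3_def K4_def \<Lambda>_def)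
  have D1: "D1_const X s s0 d0 = d0 * max M1 (max M2 M3)"
    by (simp add: D1_const_def M1_def M2_def M3_def K3_def K4_def \<Lambda>_def)
  consider (cone3) "u \<le> 3 * w" | (cone4) "3 * w < u" "u \<le> 4 * w" "A \<le> k4"
    | (signal) "3 * w < u" "k4 < A \<or> 4 * w < u"
    by linarith
  then have bounds: "u \<le> (d0 * \<rho>)\<^sup>2 * max M1 (max M2 M3) \<and> norm (restr T h) \<le> max N3 (max N2 N1) * \<rho>"
  proof cases
    case cone3
    have "u \<le> \<Lambda> * \<rho>\<^sup>2 + 9 / 4 * k3\<^sup>2"
      using cases(1)[OF cone3] B2 by linarith
    also have "\<dots> = (d0 * \<rho>)\<^sup>2 * M1"
      using \<open>0 < d0\<close> by (simp add: M1_def k3_def power2_eq_square field_simps)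
    also have "\<dots> \<le> (d0 * \<rho>)\<^sup>2 * max M1 (max M2 M3)"
      by (intro mult_left_mono) auto
    finally have off: "u \<le> (d0 * \<rho>)\<^sup>2 * max M1 (max M2 M3)" .
    have "norm (restr T h) \<le> K3 * A"
      using cone[OF RE3 cone3] by (simp add: K3_def)
    also have "\<dots> \<le> K3 * (sqrt \<Lambda> * \<rho> + 3 * k3)"
      using cases(1)[OF cone3] B K nonneg by (intro mult_left_mono) linarith+
    also have "\<dots> = N1 * \<rho>"
      by (simp add: N1_def k3_def power2_eq_square algebra_simps)
    also have "\<dots> \<le> max N3 (max N2 N1) * \<rho>"
      using pos by (intro mult_right_mono) auto
    finally show ?thesis using off by blast
  next
    case cone4
    have "u \<le> 4 * k4\<^sup>2"
      by (rule cases(2)[OF cone4])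
    also have "\<dots> = (d0 * \<rho>)\<^sup>2 * M2"
      by (simp add: M2_def k4_def power2_eq_square)
    also have "\<dots> \<le> (d0 * \<rho>)\<^sup>2 * max M1 (max M2 M3)"
      by (intro mult_left_mono) auto
    finally have off: "u \<le> (d0 * \<rho>)\<^sup>2 * max M1 (max M2 M3)" .
    have "norm (restr T h) \<le> K4 * A"
      using cone[OF RE cone4(2)] by (simp add: K4_def)
    also have "\<dots> \<le> K4 * k4"
      using cone4(3) K by (intro mult_left_mono) auto
    also have "\<dots> = N2 * \<rho>"
      by (simp add: N2_def k4_def power2_eq_square)
    also have "\<dots> \<le> max N3 (max N2 N1) * \<rho>"
      using pos by (intro mult_right_mono) auto
    finally show ?thesis using off by blast
  next
    case signal
    have u: "u \<le> 3 * \<Lambda> * \<rho>\<^sup>2" and A: "A \<le> sqrt \<Lambda> * \<rho>"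
      using cases(3)[OF signal] B B2 by auto
    note u
    also have "3 * \<Lambda> * \<rho>\<^sup>2 = (d0 * \<rho>)\<^sup>2 * M3"
      using \<open>0 < d0\<close> by (simp add: M3_def power2_eq_square)
    also have "\<dots> \<le> (d0 * \<rho>)\<^sup>2 * max M1 (max M2 M3)"
      by (intro mult_left_mono) auto
    finally have off: "u \<le> (d0 * \<rho>)\<^sup>2 * max M1 (max M2 M3)" .
    have "d0 * \<rho> * (l1norm (restr (- T) h) / sqrt (real s0)) = u"
      using s0 by (simp add: u_def l_def \<rho>_def)
    then have "l1norm (restr (- T) h) / sqrt (real s0) = u / (d0 * \<rho>)"
      using \<open>0 < d0\<close> pos by (simp add: field_simps)
    also have "\<dots> \<le> 3 * \<Lambda> * \<rho>\<^sup>2 / (d0 * \<rho>)"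
      using u \<open>0 < d0\<close> pos by (intro divide_right_mono) auto
    also have "\<dots> = 3 * \<Lambda> / d0 * \<rho>"
      using pos by (simp add: power2_eq_square)
    finally have "ell X s0 * (l1norm (restr (- T) h) / sqrt (real s0)) \<le> ell X s0 * (3 * \<Lambda> / d0 * \<rho>)"
      using p s0 Lmin by (intro mult_left_mono ell_nonneg)
    then have "sqrt (Lmin X (2 * s0)) * norm (restr T h) \<le> sqrt \<Lambda> * \<rho> + ell X s0 * (3 * \<Lambda> / d0 * \<rho>)"
      using norm_restr_le_prediction[OF p s0 T Lmin, of h] A by (simp add: A_def)
    also have "\<dots> = sqrt \<Lambda> * (1 + 3 * ell X s0 * sqrt \<Lambda> / d0) * \<rho>"
    proof -
      have "ell X s0 * (3 * \<Lambda> / d0 * \<rho>) = ell X s0 * (3 * (sqrt \<Lambda> * sqrt \<Lambda>) / d0 * \<rho>)"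
        using pos by simp
      then show ?thesis by (simp add: algebra_simps)
    qed
    also have "\<dots> = sqrt (Lmin X (2 * s0)) * (N3 * \<rho>)"
      using Lmin by (simp add: N3_def D_const_def \<Lambda>_def real_sqrt_divide)
    finally have "norm (restr T h) \<le> N3 * \<rho>"
      using Lmin by simp
    also have "\<dots> \<le> max N3 (max N2 N1) * \<rho>"
      using pos by (intro mult_right_mono) auto
    finally show ?thesis using off by blast
  qed
  then show "norm (restr T (b - c)) \<le> D0'_const X s s0 d0 * (sqrt (real s0) * \<tau>)"
    by (simp add: D0' h_def \<rho>_def)
  have "l * l1norm (restr (- T) h) \<le> l * (d0 * max M1 (max M2 M3) * (real s0 * \<tau>))"
    using bounds by (simp add: u_def l_def \<rho>_def power_mult_distrib power2_eq_square mult_ac)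
  then show "l1norm (restr (- T) (b - c)) \<le> D1_const X s s0 d0 * (real s0 * \<tau>)"
    using pos by (simp add: D1 h_def)
qed


section \<open>Least squares on a selected set\<close>

text \<open>If the \<open>I \<times> I\<close> block of a square matrix is injective, replacing the other entries by those
  of the identity makes the matrix invertible, and its inverse restricts to that of the block.\<close>

lemma block_inv_right:
  fixes A :: "real^'p^'p"
  assumes inj: "\<And>v. supp v \<subseteq> I \<Longrightarrow> (\<And>i. i \<in> I \<Longrightarrow> (A *v v) $ i = 0) \<Longrightarrow> v = 0"
    and "i \<in> I" "j \<in> I"
  shows "(\<Sum>k\<in>I. A $ i $ k * block_inv I A $ k $ j) = (if i = j then 1 else 0)"
proof -
  define M :: "real^'p^'p" where "M = (\<chi> i j. if i \<in> I \<and> j \<in> I then A $ i $ j else if i = j then 1 else 0)"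
  have M_on: "(\<Sum>k\<in>UNIV. M $ i $ k * x k) = (\<Sum>k\<in>I. A $ i $ k * x k)" if "i \<in> I" for i x
  proof -
    have "(\<Sum>k\<in>UNIV. M $ i $ k * x k) = (\<Sum>k\<in>UNIV. if k \<in> I then A $ i $ k * x k else 0)"
      using that by (intro sum.cong) (auto simp: M_def)
    then show ?thesis by (simp add: sum.inter_restrict[symmetric])
  qed
  have M_col: "(\<Sum>k\<in>UNIV. x k * M $ k $ j) = (\<Sum>k\<in>I. x k * A $ k $ j)" if "j \<in> I" for j x
  proof -
    have "(\<Sum>k\<in>UNIV. x k * M $ k $ j) = (\<Sum>k\<in>UNIV. if k \<in> I then x k * A $ k $ j else 0)"
      using that by (intro sum.cong) (auto simp: M_def)
    then show ?thesis by (simp add: sum.inter_restrict[symmetric])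
  qed
  have M_off: "(\<Sum>k\<in>UNIV. M $ i $ k * x k) = x i" if "i \<notin> I" for i x
    using that by (simp add: M_def if_distrib[of "\<lambda>t. t * _"] cong: if_cong)
  have "v = 0" if "M *v v = 0" for v
  proof -
    have Mv: "(\<Sum>k\<in>UNIV. M $ i $ k * v $ k) = 0" for i
      using that by (simp add: vec_eq_iff matrix_vector_mult_def)
    show ?thesis
    proof (rule inj)
      show "supp v \<subseteq> I"
        using Mv M_off[of _ "\<lambda>k. v $ k"] by (auto simp: supp_def)
      fix i assume "i \<in> I"
      have "(A *v v) $ i = (\<Sum>k\<in>I. A $ i $ k * v $ k)"
        unfolding matrix_vector_mult_def using \<open>supp v \<subseteq> I\<close>
        by (auto simp: supp_def intro!: sum.mono_neutral_right)
      then show "(A *v v) $ i = 0"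
        using Mv[of i] M_on[OF \<open>i \<in> I\<close>] by simp
    qed
  qed
  then obtain B where B: "B ** M = mat 1"
    by (metis matrix_left_invertible_ker)
  then have B': "M ** B = mat 1"
    by (simp add: matrix_left_right_inverse)
  have "(\<Sum>k\<in>I. A $ i $ k * B $ k $ j) = (if i = j then 1 else 0) \<and>
      (\<Sum>k\<in>I. B $ i $ k * A $ k $ j) = (if i = j then 1 else 0)" if "i \<in> I" "j \<in> I" for i j
    using arg_cong[OF B, of "\<lambda>Z. Z $ i $ j"] arg_cong[OF B', of "\<lambda>Z. Z $ i $ j"] that
    by (simp add: matrix_matrix_mult_def mat_def M_on M_col)
  then have "\<exists>B. \<forall>i\<in>I. \<forall>j\<in>I. (\<Sum>k\<in>I. A $ i $ k * B $ k $ j) = (if i = j then 1 else 0) \<and>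
      (\<Sum>k\<in>I. B $ i $ k * A $ k $ j) = (if i = j then 1 else 0)"
    by blast
  from someI_ex[OF this] show ?thesis
    using assms(2,3) unfolding block_inv_def by blast
qed

lemma supp_ols: "supp (ols X y I) \<subseteq> I"
  by (auto simp: supp_def ols_def)

lemma inner_transpose: "(X *v v) \<bullet> z = v \<bullet> (transpose X *v z)" for X :: "real^'p^'n"
  by (metis dot_lmul_matrix transpose_matrix_vector inner_commute)

lemma ols_normal_equations:
  fixes X :: "real^'p^'n"
  assumes inj: "\<And>v. supp v \<subseteq> I \<Longrightarrow> X *v v = 0 \<Longrightarrow> v = 0" and g: "supp g \<subseteq> I"
  shows "(X *v g) \<bullet> (X *v ols X y I) = (X *v g) \<bullet> y"
proof -
  define A where "A = transpose X ** X"
  define b where "b = transpose X *v y"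
  have A: "A *v v = transpose X *v (X *v v)" for v
    by (simp add: A_def matrix_vector_mul_assoc)
  have injA: "v = 0" if v: "supp v \<subseteq> I" "\<And>i. i \<in> I \<Longrightarrow> (A *v v) $ i = 0" for v
  proof -
    have "(X *v v) \<bullet> (X *v v) = v \<bullet> (A *v v)"
      by (simp add: A inner_transpose)
    also have "\<dots> = 0"
      unfolding inner_vec_def using v by (intro sum.neutral) (auto simp: supp_def)
    finally show ?thesis using inj[OF v(1)] by simp
  qed
  have inv: "(\<Sum>k\<in>I. A $ i $ k * block_inv I A $ k $ j) = (if i = j then 1 else 0)"
    if "i \<in> I" "j \<in> I" for i j
    by (rule block_inv_right) (use injA that in auto)
  have "(A *v ols X y I) $ i = b $ i" if "i \<in> I" for i
  proof -
    have "(A *v ols X y I) $ i = (\<Sum>k\<in>I. A $ i $ k * ols X y I $ k)"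
      unfolding matrix_vector_mult_def using supp_ols[of X y I]
      by (auto simp: supp_def intro!: sum.mono_neutral_right)
    also have "\<dots> = (\<Sum>k\<in>I. \<Sum>j\<in>I. (A $ i $ k * block_inv I A $ k $ j) * b $ j)"
      by (intro sum.cong refl) (simp add: ols_def A_def b_def sum_distrib_left mult.assoc)
    also have "\<dots> = (\<Sum>j\<in>I. (\<Sum>k\<in>I. A $ i $ k * block_inv I A $ k $ j) * b $ j)"
      by (subst sum.swap) (simp add: sum_distrib_right)
    also have "\<dots> = (\<Sum>j\<in>I. (if i = j then 1 else 0) * b $ j)"
      using that by (intro sum.cong) (simp_all add: inv)
    also have "\<dots> = b $ i"
      using that by (simp add: if_distrib[of "\<lambda>t. t * _"] cong: if_cong)
    finally show ?thesis .
  qed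
  then have "g \<bullet> (A *v ols X y I) = g \<bullet> b"
    unfolding inner_vec_def using g by (intro sum.cong) (force simp: supp_def)+
  then show ?thesis
    by (simp add: A b_def inner_transpose)
qed

text \<open>The error splits orthogonally into the omitted coefficients \<open>r = restr (- I) \<beta>\<close> and the estimation error
  on \<open>I\<close>. By the normal equations the latter is driven by the leakage of \<open>X *v r\<close> into the
  columns of \<open>I\<close> and by the noise.\<close>

lemma ols_error_bound:
  fixes X :: "real^'p^'n" and \<beta> :: "real^'p"
  assumes y: "y = X *v \<beta> + e"
    and noise: "\<And>j. \<bar>(transpose X *v e) $ j\<bar> \<le> real CARD('n) * \<nu>" and "0 \<le> \<nu>"
    and I: "card I \<le> m" and union: "card (I \<union> supp \<beta>) \<le> M" and Lmin: "0 < Lmin X m"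
  shows "(norm (ols X y I - \<beta>))\<^sup>2 \<le> (norm (restr (- I) \<beta>))\<^sup>2 *
      (1 + (Lmax X M - Lmin X M)\<^sup>2 / (2 * (Lmin X m)\<^sup>2)) + 2 * real m * \<nu>\<^sup>2 / (Lmin X m)\<^sup>2"
proof -
  define r g where "r = restr (- I) \<beta>" and "g = ols X y I - restr I \<beta>"
  define L \<theta> where "L = Lmin X m" and "\<theta> = (Lmax X M - Lmin X M) / 2"
  have suppg: "supp g \<subseteq> I"
    using supp_ols[of X y I] by (auto simp: g_def supp_def)
  have \<beta>: "\<beta> = restr I \<beta> + r"
    by (simp add: r_def restr_compl_add)
  have err: "ols X y I - \<beta> = g - r"
    by (subst \<beta>) (simp add: g_def)
  have "restr I (g - r) = g" "restr (- I) (g - r) = - r"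
    using suppg by (auto simp: r_def vec_eq_iff supp_def)
  then have split: "(norm (ols X y I - \<beta>))\<^sup>2 = (norm g)\<^sup>2 + (norm r)\<^sup>2"
    using norm_sq_split[of "g - r" I] err by simp
  have cardg: "card (supp g) \<le> m"
    using card_mono[OF finite suppg] I by linarith
  have inj: "v = 0" if "supp v \<subseteq> I" "X *v v = 0" for v
  proof -
    have "card (supp v) \<le> m"
      using card_mono[OF finite that(1)] I by linarith
    then have "L * (norm v)\<^sup>2 \<le> 0"
      unfolding L_def using Lmin_le_pnorm_sq[of v m X] that(2) by (simp add: pnorm_def)
    then show ?thesis
      using Lmin by (simp add: L_def mult_le_0_iff)
  qed
  have "(X *v g) \<bullet> (X *v g) = (X *v g) \<bullet> (X *v r) + (X *v g) \<bullet> e"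
  proof -
    have "(X *v g) \<bullet> (X *v ols X y I) = (X *v g) \<bullet> y"
      by (rule ols_normal_equations) (use inj suppg in auto)
    moreover have "y = X *v (restr I \<beta> + r) + e"
      using y \<beta> by simp
    ultimately show ?thesis
      by (simp add: g_def matrix_vector_mult_diff_distrib matrix_vector_right_distrib
          inner_diff_right inner_add_right)
  qed
  then have "(pnorm X g)\<^sup>2 = ((X *v g) \<bullet> (X *v r)) / real CARD('n) + ((X *v g) \<bullet> e) / real CARD('n)"
    by (simp add: pnorm_sq power2_norm_eq_inner add_divide_distrib)
  also have "((X *v g) \<bullet> (X *v r)) / real CARD('n) \<le> \<theta> * norm g * norm r"
    unfolding \<theta>_def
  proof (rule inner_le_eigenvalue_spread)
    show "supp g \<inter> supp r = {}"
      using suppg by (auto simp: r_def supp_restr)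
    show "card (supp g \<union> supp r) \<le> M"
      using suppg by (intro order_trans[OF card_mono union]) (auto simp: r_def supp_restr)
  qed
  also have "((X *v g) \<bullet> e) / real CARD('n) \<le> sqrt (real m) * \<nu> * norm g"
  proof -
    have "l1norm g \<le> sqrt (real (card I)) * norm g"
      using l1norm_restr_le[of I g] by (simp add: restr_eq_self[OF suppg])
    also have "\<dots> \<le> sqrt (real m) * norm g"
      using I by (intro mult_right_mono) auto
    finally have l1: "l1norm g \<le> sqrt (real m) * norm g" .
    have "(X *v g) \<bullet> e = (transpose X *v e) \<bullet> g"
      by (subst inner_transpose) (rule inner_commute)
    also have "\<dots> \<le> real CARD('n) * \<nu> * l1norm g"
      using abs_inner_le_const_l1norm[of "transpose X *v e", OF noise, of g] by linarith
    also have "\<dots> \<le> real CARD('n) * \<nu> * (sqrt (real m) * norm g)"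
      using l1 \<open>0 \<le> \<nu>\<close> by (intro mult_left_mono) auto
    finally show ?thesis
      by (simp add: pos_divide_le_eq mult_ac)
  qed
  finally have "L * (norm g)\<^sup>2 \<le> (\<theta> * norm r + sqrt (real m) * \<nu>) * norm g"
    using Lmin_le_pnorm_sq[OF cardg, of X] by (simp add: L_def algebra_simps)
  then have "norm g * (L * norm g) \<le> norm g * (\<theta> * norm r + sqrt (real m) * \<nu>)"
    by (simp add: power2_eq_square mult_ac)
  then have "L * norm g \<le> \<theta> * norm r + sqrt (real m) * \<nu> \<or> g = 0"
    by (metis mult_le_cancel_left_pos zero_less_norm_iff)
  then have "(norm g)\<^sup>2 \<le> 2 * \<theta>\<^sup>2 / L\<^sup>2 * (norm r)\<^sup>2 + 2 * real m * \<nu>\<^sup>2 / L\<^sup>2"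
  proof
    assume "L * norm g \<le> \<theta> * norm r + sqrt (real m) * \<nu>"
    then have "(L * norm g)\<^sup>2 \<le> (\<theta> * norm r + sqrt (real m) * \<nu>)\<^sup>2"
      using Lmin by (intro power_mono) (auto simp: L_def)
    also have "\<dots> \<le> 2 * (\<theta> * norm r)\<^sup>2 + 2 * (sqrt (real m) * \<nu>)\<^sup>2"
      using zero_le_power2[of "\<theta> * norm r - sqrt (real m) * \<nu>"]
      by (simp add: power2_sum power2_diff)
    finally have "L\<^sup>2 * (norm g)\<^sup>2 \<le> L\<^sup>2 * (2 * \<theta>\<^sup>2 / L\<^sup>2 * (norm r)\<^sup>2 + 2 * real m * \<nu>\<^sup>2 / L\<^sup>2)"
      using Lmin by (simp add: power_mult_distrib L_def distrib_left)
    then show ?thesis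
      using Lmin by (simp add: L_def)
  qed simp
  moreover define V where "V = 2 * \<theta>\<^sup>2 / L\<^sup>2"
  ultimately have "(norm g)\<^sup>2 \<le> V * (norm r)\<^sup>2 + 2 * real m * \<nu>\<^sup>2 / L\<^sup>2"
    by (simp only:)
  then have "(norm (ols X y I - \<beta>))\<^sup>2 \<le> (norm r)\<^sup>2 * (1 + V) + 2 * real m * \<nu>\<^sup>2 / L\<^sup>2"
    using mult.commute[of V "(norm r)\<^sup>2"] unfolding split distrib_left mult_1_right by linarith
  moreover have "V = (Lmax X M - Lmin X M)\<^sup>2 / (2 * (Lmin X m)\<^sup>2)"
    by (simp add: V_def \<theta>_def L_def power_divide)
  ultimately show ?thesis
    by (simp only: r_def L_def)
qed

section \<open>Essential sparsity\<close>

text \<open>Each coefficient that reaches the level \<open>\<tau>\<close> contributes \<open>\<tau>\<^sup>2\<close> to the defining sum, so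
  there are at most \<open>s0\<close> of them. Padding these positions with others from the support gives \<open>T\<close>; off \<open>T\<close> the
  minimum in the sum is the squared coefficient.\<close>

lemma essential_support:
  fixes \<beta> :: "real^'p"
  assumes "0 < \<tau>" and s0: "s0 = ess_sparsity \<beta> \<tau>"
  shows "s0 \<le> card (supp \<beta>)"
    and "\<exists>T\<subseteq>supp \<beta>. card T = s0 \<and> norm (restr (- T) \<beta>) \<le> sqrt (real s0) * \<tau>"
proof -
  let ?f = "\<lambda>i. min ((\<beta> $ i)\<^sup>2) (\<tau>\<^sup>2)"
  have f0: "0 \<le> ?f i" for i by simp
  have "sum ?f UNIV = sum ?f (supp \<beta>)"
    by (rule sum.mono_neutral_right) (auto simp: supp_def)
  also have "\<dots> \<le> (\<Sum>i\<in>supp \<beta>. \<tau>\<^sup>2)"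
    by (intro sum_mono) simp
  finally have "sum ?f UNIV \<le> real (card (supp \<beta>)) * \<tau>\<^sup>2" by simp
  then show le: "s0 \<le> card (supp \<beta>)"
    unfolding s0 ess_sparsity_def by (rule Least_le)
  have sum: "sum ?f UNIV \<le> real s0 * \<tau>\<^sup>2"
    unfolding s0 ess_sparsity_def by (rule LeastI) fact
  define H where "H = {j. \<tau> \<le> \<bar>\<beta> $ j\<bar>}"
  have H_f: "?f j = \<tau>\<^sup>2" if "j \<in> H" for j
    using that \<open>0 < \<tau>\<close> by (auto simp: H_def min_def abs_le_square_iff[symmetric])
  have H_off: "?f j = (\<beta> $ j)\<^sup>2" if "j \<notin> H" for j
    using that \<open>0 < \<tau>\<close> by (auto simp: H_def min_def abs_le_square_iff[symmetric])
  have "real (card H) * \<tau>\<^sup>2 = sum ?f H"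
    using H_f by simp
  also have "\<dots> \<le> sum ?f UNIV"
    using f0 by (intro sum_mono2) auto
  finally have "card H \<le> s0"
    using sum \<open>0 < \<tau>\<close> by (smt (verit) mult_le_cancel_right of_nat_le_iff zero_less_power)
  moreover have "H \<subseteq> supp \<beta>"
    using \<open>0 < \<tau>\<close> by (auto simp: H_def supp_def)
  ultimately obtain T where T: "H \<subseteq> T" "T \<subseteq> supp \<beta>" "card T = s0"
    using exists_subset_between[of H s0 "supp \<beta>"] le by auto
  have "(norm (restr (- T) \<beta>))\<^sup>2 = sum ?f (- T)"
    unfolding norm_restr_sq using T(1) by (intro sum.cong) (auto intro!: H_off[symmetric])
  also have "\<dots> \<le> sum ?f UNIV"
    using f0 by (intro sum_mono2) auto
  finally have "(norm (restr (- T) \<beta>))\<^sup>2 \<le> (sqrt (real s0) * \<tau>)\<^sup>2"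
    using sum by (simp add: power_mult_distrib)
  then have "norm (restr (- T) \<beta>) \<le> sqrt (real s0) * \<tau>"
    by (rule power2_le_imp_le) (use \<open>0 < \<tau>\<close> in simp)
  then show "\<exists>T\<subseteq>supp \<beta>. card T = s0 \<and> norm (restr (- T) \<beta>) \<le> sqrt (real s0) * \<tau>"
    using T by blast
qed


section \<open>The thresholded Lasso\<close>

text \<open>A coordinate selected off the essential support costs at least \<open>C4 * \<tau>\<close> of the \<open>l1\<close>
  error there, which bounds the number of false selections. A coordinate of the essential
  support is missed only if \<open>\<beta>\<close> there is at most the threshold plus the Lasso error, which
  bounds the omitted coefficients. The noise term of least squares is absorbed because
  both constants dominate multiples of \<open>d0 * (REK X s0 4)\<^sup>2\<close>, hence of \<open>\<kappa> / Lmin X (2 * s0)\<close>.\<close>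

lemma thresholded_lasso_bounds:
  fixes X :: "real^'p^'n" and \<beta> b :: "real^'p"
  assumes p: "2 \<le> CARD('p)" and "0 < \<tau>"
    and s: "s = card (supp \<beta>)" and s0: "s0 = ess_sparsity \<beta> \<tau>"
    and RE: "RE X s0 4" and Lmin: "0 < Lmin X (2 * s)"
    and y: "y = X *v \<beta> + e"
    and noise: "\<And>j. \<bar>(transpose X *v e) $ j\<bar> \<le> real CARD('n) * (\<kappa> * \<tau>)"
    and \<kappa>: "0 < \<kappa>" "2 * \<kappa> \<le> d0"
    and opt: "is_arg_min (lasso_objective X y (d0 * \<tau>)) (\<lambda>_. True) b"
    and C4: "D1_const X s s0 d0 \<le> C4" and I: "I = {j. C4 * \<tau> \<le> \<bar>b $ j\<bar>}"
  shows "real (card I) \<le> real s0 * (1 + D1_const X s s0 d0 / C4)"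
    and "real s0 * (1 + D1_const X s s0 d0 / C4) \<le> 2 * real s0"
    and "card (I \<union> supp \<beta>) \<le> s + s0"
    and "(norm (ols X y I - \<beta>))\<^sup>2 \<le> ((D0'_const X s s0 d0 + C4)\<^sup>2 + 1)
      * (3 / 2 + (Lmax X (2 * s) - Lmin X (2 * s))\<^sup>2 / (2 * (Lmin X (2 * s0))\<^sup>2)) * (real s0 * \<tau>\<^sup>2)"
proof -
  define D0 D1 K L where "D0 = D0'_const X s s0 d0" and "D1 = D1_const X s s0 d0"
    and "K = REK X s0 4" and "L = Lmin X (2 * s0)"
  have "0 < d0" using \<kappa> by simp
  have "0 < s0" using RE by (simp add: RE_def)
  have "s0 \<le> s"
    unfolding s by (rule essential_support(1)[OF \<open>0 < \<tau>\<close> s0])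
  obtain T where T: "T \<subseteq> supp \<beta>" "card T = s0" and tail: "norm (restr (- T) \<beta>) \<le> sqrt (real s0) * \<tau>"
    using essential_support(2)[OF \<open>0 < \<tau>\<close> s0] by blast
  have L: "0 < L"
    using Lmin Lmin_antimono[of "2 * s0" "2 * s" X] \<open>0 < s0\<close> \<open>s0 \<le> s\<close> by (simp add: L_def)
  have K: "0 < K"
    using REK_pos[OF RE] by (simp add: K_def)
  have D1: "d0 * (4 * K\<^sup>2) \<le> D1"
    unfolding D1_def D1_const_def K_def using \<open>0 < d0\<close> by (intro mult_left_mono) auto
  then have "0 < D1"
    using K \<open>0 < d0\<close> by (smt (verit) mult_pos_pos zero_less_power)
  then have "0 < C4" and ratio: "D1 / C4 \<le> 1"
    using C4 by (auto simp: D1_def)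
  have D0: "d0 * K\<^sup>2 \<le> D0"
    by (simp add: D0_def D0'_const_def K_def)
  then have "0 \<le> D0"
    using \<open>0 < d0\<close> by (smt (verit) mult_nonneg_nonneg zero_le_power2)
  define h where "h = b - restr T \<beta>"
  have noise': "\<bar>(transpose X *v e) $ j\<bar> \<le> real CARD('n) * (d0 * \<tau> / 2)" for j
    by (rule order_trans[OF noise]) (use \<kappa> \<open>0 < \<tau>\<close> in \<open>simp add: mult_right_mono\<close>)
  have "supp (restr (- T) \<beta>) = supp \<beta> - T"
    by (auto simp: supp_restr)
  then have tail_card: "card (supp (restr (- T) \<beta>)) \<le> s - s0"
    using T by (simp add: card_Diff_subset s)
  have y': "y = X *v (restr T \<beta> + restr (- T) \<beta>) + e"
    by (simp add: y restr_compl_add)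
  have suppT: "supp (restr T \<beta>) \<subseteq> T"
    by (auto simp: supp_restr)
  note lasso = lasso_error_bounds[OF p opt y' suppT eq_refl[OF T(2)] tail_card tail noise' RE
      L[unfolded L_def] \<open>0 < d0\<close> \<open>0 < \<tau>\<close>, folded h_def D0_def D1_def]

  have "real (card (I - T)) * (C4 * \<tau>) = (\<Sum>j\<in>I - T. C4 * \<tau>)"
    by simp
  also have "\<dots> \<le> (\<Sum>j\<in>I - T. \<bar>h $ j\<bar>)"
    by (rule sum_mono) (simp add: I h_def)
  also have "\<dots> \<le> l1norm (restr (- T) h)"
    unfolding l1norm_restr by (rule sum_mono2) auto
  also have "\<dots> \<le> D1 * (real s0 * \<tau>)"
    by (rule lasso(2))
  finally have false_real: "real (card (I - T)) \<le> real s0 * (D1 / C4)"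
    using \<open>0 < C4\<close> \<open>0 < \<tau>\<close> by (simp add: field_simps)
  also have "\<dots> \<le> real s0 * 1"
    using ratio by (rule mult_left_mono) simp
  finally have false: "card (I - T) \<le> s0" by simp
  have cardI: "card I \<le> s0 + card (I - T)"
    using card_mono[of "T \<union> (I - T)" I] card_Un_le[of T "I - T"] T(2) by fastforce
  then show "real (card I) \<le> real s0 * (1 + D1_const X s s0 d0 / C4)"
    using false_real by (simp add: D1_def algebra_simps)
  show "real s0 * (1 + D1_const X s s0 d0 / C4) \<le> 2 * real s0"
    using mult_left_mono[OF ratio, of "real s0"] by (simp add: D1_def algebra_simps)
  have "I \<union> supp \<beta> \<subseteq> supp \<beta> \<union> (I - T)"
    using T(1) by auto
  then have "card (I \<union> supp \<beta>) \<le> card (supp \<beta> \<union> (I - T))"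
    by (intro card_mono) auto
  then show union: "card (I \<union> supp \<beta>) \<le> s + s0"
    using card_Un_le[of "supp \<beta>" "I - T"] false by (simp add: s)

  define r where "r = restr (- I) \<beta>"
  have "norm (restr T r) \<le> (D0 + C4) * (sqrt (real s0) * \<tau>)"
  proof -
    have "restr T r = restr (T - I) b - restr (T - I) h"
      by (auto simp: vec_eq_iff r_def h_def)
    then have "norm (restr T r) \<le> norm (restr (T - I) b) + norm (restr (T - I) h)"
      by (simp add: norm_triangle_ineq4)
    also have "norm (restr (T - I) b) \<le> sqrt (real s0) * (C4 * \<tau>)"
    proof (rule norm_restr_le_const)
      show "card (T - I) \<le> s0"
        using card_mono[of T "T - I"] T(2) by auto
    qed (use \<open>0 < C4\<close> \<open>0 < \<tau>\<close> in \<open>auto simp: I\<close>)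
    also have "norm (restr (T - I) h) \<le> D0 * (sqrt (real s0) * \<tau>)"
      by (rule order_trans[OF norm_restr_mono lasso(1)]) auto
    finally show ?thesis by (simp add: algebra_simps)
  qed
  then have "(norm (restr T r))\<^sup>2 \<le> (D0 + C4)\<^sup>2 * (real s0 * \<tau>\<^sup>2)"
    using power_mono[of "norm (restr T r)" _ 2] by (fastforce simp: power_mult_distrib)
  moreover have "(norm (restr (- T) r))\<^sup>2 \<le> real s0 * \<tau>\<^sup>2"
  proof -
    have "norm (restr (- T) r) \<le> norm (restr (- T) \<beta>)"
      unfolding r_def restr_inter by (rule norm_restr_mono) auto
    also note tail
    finally show ?thesis
      using power_mono[of "norm (restr (- T) r)" _ 2] by (fastforce simp: power_mult_distrib)
  qed
  ultimately have r: "(norm r)\<^sup>2 \<le> ((D0 + C4)\<^sup>2 + 1) * (real s0 * \<tau>\<^sup>2)"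
    using norm_sq_split[of r T] by (simp add: algebra_simps)

  have noise_term: "4 * \<kappa>\<^sup>2 / L\<^sup>2 \<le> ((D0 + C4)\<^sup>2 + 1) / 2"
  proof -
    \<comment> \<open>of the multiple \<open>5 * d0 * K\<^sup>2\<close> below \<open>D0 + C4\<close>, one part comes from \<open>D0\<close> and four from \<open>C4\<close>\<close>
    have "\<kappa> * 1 \<le> \<kappa> * (2 * K\<^sup>2 * L)"
      using Lmin_ge_RE[OF RE] \<kappa> by (intro mult_left_mono) (auto simp: K_def L_def)
    then have "\<kappa> / L \<le> 2 * \<kappa> * K\<^sup>2"
      using L by (simp add: divide_le_eq mult_ac)
    also have "\<dots> \<le> d0 * K\<^sup>2"
      using \<kappa> by (intro mult_right_mono) auto
    finally have "5 * (\<kappa> / L) \<le> D0 + C4"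
      using D0 D1 C4 by (simp add: D1_def)
    then have "(5 * (\<kappa> / L))\<^sup>2 \<le> (D0 + C4)\<^sup>2"
      using \<kappa> L by (intro power_mono) auto
    moreover define x where "x = (\<kappa> / L)\<^sup>2"
    ultimately have "25 * x \<le> (D0 + C4)\<^sup>2"
      by (simp add: power_mult_distrib power_divide)
    moreover have "0 \<le> x" by (simp add: x_def)
    ultimately have "4 * x \<le> ((D0 + C4)\<^sup>2 + 1) / 2" by simp
    then show ?thesis by (simp add: x_def power_divide)
  qed
  define V where "V = (Lmax X (2 * s) - Lmin X (2 * s))\<^sup>2 / (2 * L\<^sup>2)"
  have "0 \<le> V" by (simp add: V_def)
  have "(norm (ols X y I - \<beta>))\<^sup>2 \<le> (norm r)\<^sup>2 * (1 + V) + 2 * real (2 * s0) * (\<kappa> * \<tau>)\<^sup>2 / L\<^sup>2"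
    unfolding r_def V_def L_def
  proof (rule ols_error_bound[OF y noise])
    show "card I \<le> 2 * s0" "card (I \<union> supp \<beta>) \<le> 2 * s"
      using cardI false union \<open>s0 \<le> s\<close> by auto
  qed (use \<kappa> \<open>0 < \<tau>\<close> L in \<open>auto simp: L_def\<close>)
  also have "(norm r)\<^sup>2 * (1 + V) \<le> ((D0 + C4)\<^sup>2 + 1) * (real s0 * \<tau>\<^sup>2) * (1 + V)"
    using r \<open>0 \<le> V\<close> by (intro mult_right_mono) auto
  also have "2 * real (2 * s0) * (\<kappa> * \<tau>)\<^sup>2 / L\<^sup>2 = 4 * \<kappa>\<^sup>2 / L\<^sup>2 * (real s0 * \<tau>\<^sup>2)"
    by (simp add: power_mult_distrib)
  also have "\<dots> \<le> ((D0 + C4)\<^sup>2 + 1) / 2 * (real s0 * \<tau>\<^sup>2)"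
    using noise_term by (rule mult_right_mono) simp
  also have "((D0 + C4)\<^sup>2 + 1) * (real s0 * \<tau>\<^sup>2) * (1 + V) + ((D0 + C4)\<^sup>2 + 1) / 2 * (real s0 * \<tau>\<^sup>2)
      = ((D0 + C4)\<^sup>2 + 1) * (3 / 2 + V) * (real s0 * \<tau>\<^sup>2)"
    by (simp add: field_simps)
  finally show "(norm (ols X y I - \<beta>))\<^sup>2 \<le> ((D0'_const X s s0 d0 + C4)\<^sup>2 + 1)
      * (3 / 2 + (Lmax X (2 * s) - Lmin X (2 * s))\<^sup>2 / (2 * (Lmin X (2 * s0))\<^sup>2)) * (real s0 * \<tau>\<^sup>2)"
    by (simp add: D0_def V_def L_def)
qed

lemma noise_event_measurable:
  fixes X :: "real^'p^'n"
  shows "noise_event X \<sigma> a \<in> sets borel"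
proof -
  have "closed (noise_event X \<sigma> a)"
    unfolding noise_event_def
    by (intro closed_Collect_le continuous_on_infnorm continuous_intros
        linear_continuous_on matrix_vector_mul_bounded_linear)
  then show ?thesis by simp
qed

theorem theorem2p1:
  fixes X :: "real^'p^'n"
    and \<beta> :: "real^'p"
    and M :: "'w measure"
    and \<epsilon> Y :: "'w \<Rightarrow> real^'n"
    and \<beta>init \<beta>hat :: "'w \<Rightarrow> real^'p"
    and I :: "'w \<Rightarrow> 'p set"
    and S :: "'p set"
    and s s0 :: nat
    and \<sigma> lam a d0 lam_n C4 t0 :: real
  assumes "CARD('p) \<ge> CARD('n)" and "CARD('p) \<ge> 2"
    and "\<sigma> > 0"
    and lam: "lam = sqrt (2 * ln (real CARD('p)) / real CARD('n))"
    and columns: "\<And>j. norm (column j X) = sqrt (real CARD('n))"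
    and S: "S = supp \<beta>" and s: "s = card S"
    and s0: "s0 = ess_sparsity \<beta> (lam * \<sigma>)"
    and M: "prob_space M"
    and indep: "prob_space.indep_vars M (\<lambda>_. borel) (\<lambda>i \<omega>. \<epsilon> \<omega> $ i) UNIV"
    and normal: "\<And>i. distributed M lborel (\<lambda>\<omega>. \<epsilon> \<omega> $ i) (\<lambda>x. ennreal (normal_density 0 \<sigma> x))"
    and Y: "\<And>\<omega>. Y \<omega> = X *v \<beta> + \<epsilon> \<omega>"
    and RE: "RE X s0 4"
    and Lmax_finite: "bdd_above (sparse_quotients X (2 * s))"
    and Lmin_pos: "Lmin X (2 * s) > 0"
    and a: "a \<ge> 0"
    and d0: "d0 \<ge> 2 * sqrt (1 + a)"
    and lam_n: "lam_n = d0 * lam * \<sigma>"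
    and lasso: "\<And>\<omega>. \<omega> \<in> space M \<Longrightarrow>
                  is_arg_min (lasso_objective X (Y \<omega>) lam_n) (\<lambda>_. True) (\<beta>init \<omega>)"
    and C4: "C4 \<ge> D1_const X s s0 d0"
    and t0: "t0 = C4 * lam * \<sigma>" "t0 \<ge> 2 * sqrt (1 + a) * lam * \<sigma>"
    and I: "\<And>\<omega>. I \<omega> = {j. \<bar>\<beta>init \<omega> $ j\<bar> \<ge> t0}"
    and \<beta>hat: "\<And>\<omega>. \<beta>hat \<omega> = ols X (Y \<omega>) (I \<omega>)"
  shows "\<exists>D4::real.
    D4\<^sup>2 \<le> ((D0'_const X s s0 d0 + C4)\<^sup>2 + 1)
            * (3 / 2 + (Lmax X (2 * s) - Lmin X (2 * s))\<^sup>2 / (2 * (Lmin X (2 * s0))\<^sup>2)) \<and>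
    (\<exists>A\<in>sets M.
       measure M A \<ge> 1 - measure M {\<omega> \<in> space M. \<epsilon> \<omega> \<in> - noise_event X \<sigma> a} \<and>
       (\<forall>\<omega>\<in>A.
          real (card (I \<omega>)) \<le> real s0 * (1 + D1_const X s s0 d0 / C4) \<and>
          real s0 * (1 + D1_const X s s0 d0 / C4) \<le> 2 * real s0 \<and>
          card (I \<omega> \<union> S) \<le> s + s0 \<and>
          (norm (\<beta>hat \<omega> - \<beta>))\<^sup>2 \<le> D4\<^sup>2 * real s0 * lam\<^sup>2 * \<sigma>\<^sup>2))"
proof -
  interpret prob_space M by (rule M)
  define \<tau> where "\<tau> = lam * \<sigma>"
  define R where "R = ((D0'_const X s s0 d0 + C4)\<^sup>2 + 1)
    * (3 / 2 + (Lmax X (2 * s) - Lmin X (2 * s))\<^sup>2 / (2 * (Lmin X (2 * s0))\<^sup>2))"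
  have "0 \<le> R" by (simp add: R_def)
  have "0 < lam"
    using \<open>CARD('p) \<ge> 2\<close> by (simp add: lam)
  then have "0 < \<tau>"
    using \<open>\<sigma> > 0\<close> by (simp add: \<tau>_def)
  define A where "A = {\<omega> \<in> space M. \<epsilon> \<omega> \<in> noise_event X \<sigma> a}"
  have "\<epsilon> \<in> borel_measurable M"
    unfolding borel_measurable_euclidean_space[of \<epsilon>]
    using normal by (auto simp: Basis_vec_def inner_axis distributed_def)
  from measurable_sets[OF this noise_event_measurable, of X \<sigma> a] have A: "A \<in> sets M"
    by (simp add: A_def vimage_def Int_def conj_commute)
  have "{\<omega> \<in> space M. \<epsilon> \<omega> \<in> - noise_event X \<sigma> a} = space M - A"
    by (auto simp: A_def)
  then have prob: "1 - measure M {\<omega> \<in> space M. \<epsilon> \<omega> \<in> - noise_event X \<sigma> a} \<le> measure M A"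
    using prob_compl[OF A] by simp
  have "real (card (I \<omega>)) \<le> real s0 * (1 + D1_const X s s0 d0 / C4) \<and>
      real s0 * (1 + D1_const X s s0 d0 / C4) \<le> 2 * real s0 \<and>
      card (I \<omega> \<union> S) \<le> s + s0 \<and>
      (norm (\<beta>hat \<omega> - \<beta>))\<^sup>2 \<le> (sqrt R)\<^sup>2 * real s0 * lam\<^sup>2 * \<sigma>\<^sup>2" if \<omega>: "\<omega> \<in> A" for \<omega>
  proof -
    have noise: "\<bar>(transpose X *v \<epsilon> \<omega>) $ j\<bar> \<le> real CARD('n) * (sqrt (1 + a) * \<tau>)" for j
    proof -
      have "\<bar>((1 / real CARD('n)) *\<^sub>R (transpose X *v \<epsilon> \<omega>)) $ j\<bar> \<le> noise_level X \<sigma> a"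
        using \<omega> component_le_infnorm_cart[of "(1 / real CARD('n)) *\<^sub>R (transpose X *v \<epsilon> \<omega>)" j]
        by (simp add: A_def noise_event_def)
      then show ?thesis
        by (simp add: noise_level_def \<tau>_def lam field_simps abs_mult)
    qed
    have opt: "is_arg_min (lasso_objective X (Y \<omega>) (d0 * \<tau>)) (\<lambda>_. True) (\<beta>init \<omega>)"
      using lasso[of \<omega>] \<omega> by (simp add: A_def lam_n \<tau>_def mult.assoc)
    have I': "I \<omega> = {j. C4 * \<tau> \<le> \<bar>\<beta>init \<omega> $ j\<bar>}"
      by (simp add: I t0(1) \<tau>_def mult.assoc)
    have "0 < sqrt (1 + a)" using a by simp
    note bounds = thresholded_lasso_bounds[OF \<open>CARD('p) \<ge> 2\<close> \<open>0 < \<tau>\<close> s[unfolded S] s0[folded \<tau>_def]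
        RE Lmin_pos Y[of \<omega>] noise this d0 opt C4 I']
    show ?thesis
      using bounds \<open>0 \<le> R\<close>
      by (simp add: S \<beta>hat R_def[symmetric] \<tau>_def power_mult_distrib mult.assoc)
  qed
  then show ?thesis
    using A prob \<open>0 \<le> R\<close> unfolding R_def[symmetric]
    by (intro exI[of _ "sqrt R"] conjI bexI[of _ A]) auto
qed

end
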